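(* Let $(\mathcal{M},g,K)$ be an optical geometry with congruence of null curves $\mathcal{K}$ and intrinsic torsion $\mathring{T}$. Then (1) $\mathcal{K}$ is non-expanding geodetic if and only if $\mathring{T}\in\Gamma(\mathcal{N}_{-1}^0)$; (2) $\mathcal{K}$ is non-twisting geodetic if and only if $\mathring{T}\in\Gamma(\mathcal{N}_{-1}^1)$; (3) $\mathcal{K}$ is non-shearing geodetic if and only if $\mathring{T}\in\Gamma(\mathcal{N}_{-1}^2)$. Here $\mathcal{N}_{-1}^j$ denotes the subbundles of $\mathcal{G}$ defined in the context.
   Context: An optical geometry $(\mathcal{M},g,K)$ is an oriented and time-oriented Lorentzian manifold $(\mathcal{M},g)$ of dimension $n+2$ with a null line distribution $K\subset T\mathcal{M}$. $\nabla$ is the Levi-Civita connection, $H_K=K^\perp/K$ the screen bundle with induced positive definite metric $h(v+K,w+K)=g(v,w)$. $\mathcal{K}$ is the foliation by curves tangent to $K$; a generator is a non-vanishing section $k$ of $K$. $\mathcal{K}$ is geodetic if $\nabla_kk\in\Gamma(K)$. If so, with $\kappa=g(k,\cdot)$, define for $v,w\in\Gamma(K^\perp)$ the expansion $\epsilon$, twist $\tau$ and shear $\sigma$ of $k$ by $\epsilon\,\kappa=\kappa\,\mathrm{div}\,k-\nabla_k\kappa$, $\tau(v+K,w+K)=\mathrm{d}\kappa(v,w)$, $\sigma(v+K,w+K)=\frac12\mathcal{L}_kg(v,w)-\frac1n\epsilon\,g(v,w)$; $\mathcal{K}$ is non-expanding, non-twisting, non-shearing if $\epsilon=0$, $\tau=0$,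 $\sigma=0$ respectively (independent of $k$). The intrinsic torsion is the section $\mathring T$ of $\mathcal{G}=T^*\mathcal{M}\otimes H_K^*\otimes K^*$ given by $\mathring T(v;w+K;k)=g(\nabla_vk,w)$, $v\in\Gamma(T\mathcal{M})$, $w\in\Gamma(K^\perp)$, $k\in\Gamma(K)$. (This is the projection of the Levi-Civita connection form to $\mathfrak{g}/\mathfrak{p}$ in frames adapted to $K$, where $\mathfrak{g}=\mathfrak{so}(n+1,1)$ and $\mathfrak{p}=\mathfrak{sim}(n)$ is the stabiliser of a null line.) Put $\mathcal{G}^{-1}=\mathrm{Ann}(K)\otimes H_K^*\otimes K^*$ and $\mathcal{G}^0=\mathrm{Ann}(K^\perp)\otimes H_K^*\otimes K^*$, so $\mathcal{G}^{-1}/\mathcal{G}^0\cong H_K^*\otimes H_K^*\otimes K^*$. The subbundle $\mathcal{N}_{-1}^j\subset\mathcal{G}^{-1}$ consists of those elements whose image $A_{ij}$ in $H_K^*\otimes H_K^*\otimes K^*$ satisfies: $h^{ij}A_{ij}=0$ for $j=0$; $A_{[ij]}=0$ for $j=1$; the trace-free symmetric part $A_{(ij)_\circ}=0$ for $j=2$. *)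

theory Defs
  imports "HOL-Analysis.Analysis"
begin

section \<open>Smooth maps between Euclidean spaces\<close>

text \<open>Meant for open \<open>S\<close> in a finite-dimensional space, where requiring all directional
  derivatives to be of class \<open>C\<^sup>k\<close> is the usual definition of class \<open>C\<^sup>k\<^sup>+\<^sup>1\<close>.\<close>

primrec Ck_on :: "nat \<Rightarrow> 'v::real_normed_vector set \<Rightarrow> ('v \<Rightarrow> 'w::real_normed_vector) \<Rightarrow> bool" where
  "Ck_on 0 S f \<longleftrightarrow> continuous_on S f"
| "Ck_on (Suc k) S f \<longleftrightarrow>
     f differentiable_on S \<and> (\<forall>v. Ck_on k S (\<lambda>x. frechet_derivative f (at x) v))"

definition smooth_on :: "'v::real_normed_vector set \<Rightarrow> ('v \<Rightarrow> 'w::real_normed_vector) \<Rightarrow> bool" where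
  "smooth_on S f \<longleftrightarrow> (\<forall>k. Ck_on k S f)"


section \<open>Manifolds, tangent vectors and fields\<close>

text \<open>The data of an optical geometry. A chart is a pair of its domain and its coordinate map.
  For every point \<open>p\<close> we fix one chart around it (\<open>chart_at\<close>) and identify the tangent space at
  \<open>p\<close> with \<open>real ^ 'n\<close> through the differential of that chart. Hence a vector field is a function
  \<open>'a \<Rightarrow> real ^ 'n\<close>, and its smoothness has to be read off after passing, at each point, from the
  chosen chart to one common chart (\<open>comps\<close>, \<open>local_rep\<close>).

  The time orientation is represented by a timelike vector field; the orientation is the one for
  which all charts of the atlas are positively oriented.\<close>

record ('a, 'n) optical =
  pts :: "'a topology"
  atlas :: "('a set \<times> ('a \<Rightarrow> real ^ 'n)) set"
  metric :: "'a \<Rightarrow> real ^ 'n \<Rightarrow> real ^ 'n \<Rightarrow> real"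
  time_field :: "'a \<Rightarrow> real ^ 'n"
  null_line :: "'a \<Rightarrow> (real ^ 'n) set"

abbreviation chart_inv :: "'a set \<times> ('a \<Rightarrow> real ^ 'n) \<Rightarrow> real ^ 'n \<Rightarrow> 'a" where
  "chart_inv c \<equiv> inv_into (fst c) (snd c)"

definition oriented_manifold :: "('a, 'n::finite) optical \<Rightarrow> bool" where
  "oriented_manifold Q \<longleftrightarrow>
     Hausdorff_space (pts Q) \<and>
     (\<exists>\<B>. countable \<B> \<and> (\<forall>B\<in>\<B>. openin (pts Q) B) \<and>
        (\<forall>U p. openin (pts Q) U \<and> p \<in> U \<longrightarrow> (\<exists>B\<in>\<B>. p \<in> B \<and> B \<subseteq> U))) \<and>
     (\<Union>c\<in>atlas Q. fst c) = topspace (pts Q) \<and>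
     (\<forall>c\<in>atlas Q. openin (pts Q) (fst c) \<and> open (snd c ` fst c) \<and>
        homeomorphic_map (subtopology (pts Q) (fst c)) (top_of_set (snd c ` fst c)) (snd c)) \<and>
     (\<forall>c\<in>atlas Q. \<forall>d\<in>atlas Q. smooth_on (snd c ` (fst c \<inter> fst d)) (snd d \<circ> chart_inv c)) \<and>
     (\<forall>c\<in>atlas Q. \<forall>d\<in>atlas Q. \<forall>p\<in>fst c \<inter> fst d.
        det (jacobian (snd d \<circ> chart_inv c) (at (snd c p))) > 0)"

definition chart_at :: "('a, 'n::finite) optical \<Rightarrow> 'a \<Rightarrow> 'a set \<times> ('a \<Rightarrow> real ^ 'n)" where
  "chart_at Q p = (SOME c. c \<in> atlas Q \<and> p \<in> fst c)"

text \<open>The components in the chart \<open>c\<close> of the tangent vector \<open>v\<close> at \<open>p\<close>.\<close>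

definition comps ::
  "('a, 'n::finite) optical \<Rightarrow> 'a set \<times> ('a \<Rightarrow> real ^ 'n) \<Rightarrow> 'a \<Rightarrow> real ^ 'n \<Rightarrow> real ^ 'n" where
  "comps Q c p v =
     frechet_derivative (snd c \<circ> chart_inv (chart_at Q p)) (at (snd (chart_at Q p) p)) v"

definition local_rep ::
  "('a, 'n::finite) optical \<Rightarrow> 'a set \<times> ('a \<Rightarrow> real ^ 'n) \<Rightarrow> ('a \<Rightarrow> real ^ 'n)
     \<Rightarrow> real ^ 'n \<Rightarrow> real ^ 'n" where
  "local_rep Q c X = (\<lambda>x. comps Q c (chart_inv c x) (X (chart_inv c x)))"

definition smooth_fun :: "('a, 'n::finite) optical \<Rightarrow> 'a set \<Rightarrow> ('a \<Rightarrow> real) \<Rightarrow> bool" where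
  "smooth_fun Q U f \<longleftrightarrow> (\<forall>c\<in>atlas Q. smooth_on (snd c ` (fst c \<inter> U)) (f \<circ> chart_inv c))"

definition smooth_field ::
  "('a, 'n::finite) optical \<Rightarrow> 'a set \<Rightarrow> ('a \<Rightarrow> real ^ 'n) \<Rightarrow> bool" where
  "smooth_field Q U X \<longleftrightarrow> (\<forall>c\<in>atlas Q. smooth_on (snd c ` (fst c \<inter> U)) (local_rep Q c X))"

definition near :: "('a, 'n::finite) optical \<Rightarrow> 'a \<Rightarrow> ('a set \<Rightarrow> bool) \<Rightarrow> bool" where
  "near Q p P \<longleftrightarrow> (\<exists>U. openin (pts Q) U \<and> p \<in> U \<and> P U)"

definition dir_deriv :: "('a, 'n::finite) optical \<Rightarrow> 'a \<Rightarrow> real ^ 'n \<Rightarrow> ('a \<Rightarrow> real) \<Rightarrow> real" where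
  "dir_deriv Q p v f =
     frechet_derivative (f \<circ> chart_inv (chart_at Q p)) (at (snd (chart_at Q p) p)) v"

definition lie_bracket ::
  "('a, 'n::finite) optical \<Rightarrow> ('a \<Rightarrow> real ^ 'n) \<Rightarrow> ('a \<Rightarrow> real ^ 'n) \<Rightarrow> 'a \<Rightarrow> real ^ 'n" where
  "lie_bracket Q X Y p = (let c = chart_at Q p in
     frechet_derivative (local_rep Q c Y) (at (snd c p)) (X p)
     - frechet_derivative (local_rep Q c X) (at (snd c p)) (Y p))"

text \<open>A 1-form \<open>\<alpha>\<close> is a function assigning to each point a linear form.\<close>

definition ext_deriv ::
  "('a, 'n::finite) optical \<Rightarrow> ('a \<Rightarrow> real ^ 'n \<Rightarrow> real)
     \<Rightarrow> ('a \<Rightarrow> real ^ 'n) \<Rightarrow> ('a \<Rightarrow> real ^ 'n) \<Rightarrow> 'a \<Rightarrow> real" where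
  "ext_deriv Q \<alpha> X Y p =
     dir_deriv Q p (X p) (\<lambda>q. \<alpha> q (Y q)) - dir_deriv Q p (Y p) (\<lambda>q. \<alpha> q (X q))
     - \<alpha> p (lie_bracket Q X Y p)"

definition lie_metric ::
  "('a, 'n::finite) optical \<Rightarrow> ('a \<Rightarrow> real ^ 'n) \<Rightarrow> ('a \<Rightarrow> real ^ 'n) \<Rightarrow> ('a \<Rightarrow> real ^ 'n)
     \<Rightarrow> 'a \<Rightarrow> real" where
  "lie_metric Q Z X Y p =
     dir_deriv Q p (Z p) (\<lambda>q. metric Q q (X q) (Y q))
     - metric Q p (lie_bracket Q Z X p) (Y p) - metric Q p (X p) (lie_bracket Q Z Y p)"


section \<open>Optical geometries\<close>

text \<open>A symmetric bilinear form of signature \<open>(-, +, \<dots>, +)\<close>, by means of an orthonormal frame.\<close>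

definition lorentzian_form :: "(real ^ 'n \<Rightarrow> real ^ 'n \<Rightarrow> real) \<Rightarrow> bool" where
  "lorentzian_form B \<longleftrightarrow> bilinear B \<and> (\<forall>v w. B v w = B w v) \<and>
     (\<exists>(e :: 'n \<Rightarrow> real ^ 'n) i\<^sub>0. \<forall>i j.
        B (e i) (e j) = (if i \<noteq> j then 0 else if i = i\<^sub>0 then -1 else 1))"

definition lorentzian_metric :: "('a, 'n::finite) optical \<Rightarrow> bool" where
  "lorentzian_metric Q \<longleftrightarrow>
     (\<forall>p\<in>topspace (pts Q). lorentzian_form (metric Q p)) \<and>
     (\<forall>U X Y. openin (pts Q) U \<and> smooth_field Q U X \<and> smooth_field Q U Y
        \<longrightarrow> smooth_fun Q U (\<lambda>p. metric Q p (X p) (Y p)))"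

definition time_orientation :: "('a, 'n::finite) optical \<Rightarrow> bool" where
  "time_orientation Q \<longleftrightarrow>
     smooth_field Q (topspace (pts Q)) (time_field Q) \<and>
     (\<forall>p\<in>topspace (pts Q). metric Q p (time_field Q p) (time_field Q p) < 0)"

definition null_line_distribution :: "('a, 'n::finite) optical \<Rightarrow> bool" where
  "null_line_distribution Q \<longleftrightarrow>
     (\<forall>p\<in>topspace (pts Q).
        subspace (null_line Q p) \<and> dim (null_line Q p) = 1 \<and>
        (\<forall>v\<in>null_line Q p. metric Q p v v = 0) \<and>
        near Q p (\<lambda>U. \<exists>X. smooth_field Q U X \<and> (\<forall>q\<in>U. X q \<in> null_line Q q \<and> X q \<noteq> 0)))"

definition optical_geometry :: "nat \<Rightarrow> ('a, 'n::finite) optical \<Rightarrow> bool" where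
  "optical_geometry n Q \<longleftrightarrow> CARD('n) = n + 2 \<and>
     oriented_manifold Q \<and> lorentzian_metric Q \<and> time_orientation Q \<and> null_line_distribution Q"

definition null_perp :: "('a, 'n::finite) optical \<Rightarrow> 'a \<Rightarrow> (real ^ 'n) set" where
  "null_perp Q p = {w. \<forall>v\<in>null_line Q p. metric Q p v w = 0}"

definition section_on ::
  "('a, 'n::finite) optical \<Rightarrow> ('a \<Rightarrow> (real ^ 'n) set) \<Rightarrow> 'a set \<Rightarrow> ('a \<Rightarrow> real ^ 'n) \<Rightarrow> bool" where
  "section_on Q D U X \<longleftrightarrow> openin (pts Q) U \<and> smooth_field Q U X \<and> (\<forall>p\<in>U. X p \<in> D p)"

definition generator_on ::
  "('a, 'n::finite) optical \<Rightarrow> 'a set \<Rightarrow> ('a \<Rightarrow> real ^ 'n) \<Rightarrow> bool" where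
  "generator_on Q U k \<longleftrightarrow> section_on Q (null_line Q) U k \<and> (\<forall>p\<in>U. k p \<noteq> 0)"

text \<open>The fibre at \<open>p\<close> of the screen bundle \<open>H\<^sub>K = K\<^sup>\<bottom> / K\<close>, as a set of cosets, and its metric.\<close>

definition coset :: "('a, 'n::finite) optical \<Rightarrow> 'a \<Rightarrow> real ^ 'n \<Rightarrow> (real ^ 'n) set" where
  "coset Q p w = (\<lambda>x. w + x) ` null_line Q p"

definition screen :: "('a, 'n::finite) optical \<Rightarrow> 'a \<Rightarrow> (real ^ 'n) set set" where
  "screen Q p = coset Q p ` null_perp Q p"

definition screen_metric ::
  "('a, 'n::finite) optical \<Rightarrow> 'a \<Rightarrow> (real ^ 'n) set \<Rightarrow> (real ^ 'n) set \<Rightarrow> real" where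
  "screen_metric Q p V W = metric Q p (SOME v. v \<in> V) (SOME w. w \<in> W)"

definition screen_frame ::
  "nat \<Rightarrow> ('a, 'n::finite) optical \<Rightarrow> 'a \<Rightarrow> nat \<Rightarrow> (real ^ 'n) set" where
  "screen_frame n Q p = (SOME E. (\<forall>i<n. E i \<in> screen Q p) \<and>
     (\<forall>i<n. \<forall>j<n. screen_metric Q p (E i) (E j) = (if i = j then 1 else 0)))"

text \<open>The trace \<open>h\<^sup>i\<^sup>j A\<^sub>i\<^sub>j\<close>, computed in an orthonormal basis of the screen space.\<close>

definition screen_trace ::
  "nat \<Rightarrow> ('a, 'n::finite) optical \<Rightarrow> 'a \<Rightarrow> ((real ^ 'n) set \<Rightarrow> (real ^ 'n) set \<Rightarrow> real) \<Rightarrow> real" where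
  "screen_trace n Q p A = (\<Sum>i<n. A (screen_frame n Q p i) (screen_frame n Q p i))"


section \<open>The Levi-Civita connection\<close>

text \<open>A covariant derivative takes a point \<open>p\<close>, a tangent vector \<open>v\<close> at \<open>p\<close> and a vector field
  \<open>Y\<close> that is smooth near \<open>p\<close>, and returns \<open>\<nabla>\<^sub>v Y\<close>. Applying the Leibniz rule to a function that
  vanishes near \<open>p\<close> and is \<open>1\<close> further away shows that only the germ of \<open>Y\<close> matters.\<close>

type_synonym ('a, 'n) cov_deriv = "'a \<Rightarrow> real ^ 'n \<Rightarrow> ('a \<Rightarrow> real ^ 'n) \<Rightarrow> real ^ 'n"

definition connection :: "('a, 'n::finite) optical \<Rightarrow> ('a, 'n) cov_deriv \<Rightarrow> bool" where
  "connection Q nabla \<longleftrightarrow>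
     (\<forall>p\<in>topspace (pts Q). \<forall>Y. near Q p (\<lambda>U. smooth_field Q U Y) \<longrightarrow>
        linear (\<lambda>v. nabla p v Y)) \<and>
     (\<forall>p\<in>topspace (pts Q). \<forall>v Y Z.
        near Q p (\<lambda>U. smooth_field Q U Y \<and> smooth_field Q U Z) \<longrightarrow>
        nabla p v (\<lambda>q. Y q + Z q) = nabla p v Y + nabla p v Z) \<and>
     (\<forall>p\<in>topspace (pts Q). \<forall>v f Y.
        near Q p (\<lambda>U. smooth_fun Q U f \<and> smooth_field Q U Y) \<longrightarrow>
        nabla p v (\<lambda>q. f q *\<^sub>R Y q) = dir_deriv Q p v f *\<^sub>R Y p + f p *\<^sub>R nabla p v Y) \<and>
     (\<forall>U X Y. openin (pts Q) U \<and> smooth_field Q U X \<and> smooth_field Q U Y \<longrightarrow>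
        smooth_field Q U (\<lambda>p. nabla p (X p) Y))"

definition levi_civita :: "('a, 'n::finite) optical \<Rightarrow> ('a, 'n) cov_deriv \<Rightarrow> bool" where
  "levi_civita Q nabla \<longleftrightarrow> connection Q nabla \<and>
     (\<forall>p\<in>topspace (pts Q). \<forall>v X Y.
        near Q p (\<lambda>U. smooth_field Q U X \<and> smooth_field Q U Y) \<longrightarrow>
        dir_deriv Q p v (\<lambda>q. metric Q q (X q) (Y q))
          = metric Q p (nabla p v X) (Y p) + metric Q p (X p) (nabla p v Y)) \<and>
     (\<forall>p\<in>topspace (pts Q). \<forall>X Y.
        near Q p (\<lambda>U. smooth_field Q U X \<and> smooth_field Q U Y) \<longrightarrow>
        nabla p (X p) Y - nabla p (Y p) X = lie_bracket Q X Y p)"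

definition divergence ::
  "('a, 'n::finite) cov_deriv \<Rightarrow> ('a \<Rightarrow> real ^ 'n) \<Rightarrow> 'a \<Rightarrow> real" where
  "divergence nabla X p = trace (matrix (\<lambda>v. nabla p v X))"

text \<open>\<open>(\<nabla>\<^sub>v \<alpha>)(Y)\<close> for a 1-form \<open>\<alpha>\<close>, with \<open>v\<close> a tangent vector at \<open>p\<close>.\<close>

definition cov_deriv_form ::
  "('a, 'n::finite) optical \<Rightarrow> ('a, 'n) cov_deriv \<Rightarrow> 'a \<Rightarrow> real ^ 'n
     \<Rightarrow> ('a \<Rightarrow> real ^ 'n \<Rightarrow> real) \<Rightarrow> ('a \<Rightarrow> real ^ 'n) \<Rightarrow> real" where
  "cov_deriv_form Q nabla p v \<alpha> Y = dir_deriv Q p v (\<lambda>q. \<alpha> q (Y q)) - \<alpha> p (nabla p v Y)"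


section \<open>Optical invariants of the congruence\<close>

definition flat_form ::
  "('a, 'n::finite) optical \<Rightarrow> ('a \<Rightarrow> real ^ 'n) \<Rightarrow> 'a \<Rightarrow> real ^ 'n \<Rightarrow> real" where
  "flat_form Q k p v = metric Q p (k p) v"

definition expansion ::
  "('a, 'n::finite) optical \<Rightarrow> ('a, 'n) cov_deriv \<Rightarrow> ('a \<Rightarrow> real ^ 'n) \<Rightarrow> 'a \<Rightarrow> real" where
  "expansion Q nabla k p = (THE e. \<forall>Y. near Q p (\<lambda>U. smooth_field Q U Y) \<longrightarrow>
     e * flat_form Q k p (Y p) =
       flat_form Q k p (Y p) * divergence nabla k p
       - cov_deriv_form Q nabla p (k p) (flat_form Q k) Y)"

text \<open>Twist and shear are bilinear forms on the screen space; their values are computed from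
  any local sections of \<open>K\<^sup>\<bottom>\<close> representing the two cosets at \<open>p\<close>.\<close>

definition twist ::
  "('a, 'n::finite) optical \<Rightarrow> ('a \<Rightarrow> real ^ 'n) \<Rightarrow> 'a
     \<Rightarrow> (real ^ 'n) set \<Rightarrow> (real ^ 'n) set \<Rightarrow> real" where
  "twist Q k p V W = (THE c. \<exists>X Y.
     near Q p (\<lambda>U. section_on Q (null_perp Q) U X \<and> section_on Q (null_perp Q) U Y) \<and>
     X p \<in> V \<and> Y p \<in> W \<and> c = ext_deriv Q (flat_form Q k) X Y p)"

definition shear ::
  "nat \<Rightarrow> ('a, 'n::finite) optical \<Rightarrow> ('a, 'n) cov_deriv \<Rightarrow> ('a \<Rightarrow> real ^ 'n) \<Rightarrow> 'a
     \<Rightarrow> (real ^ 'n) set \<Rightarrow> (real ^ 'n) set \<Rightarrow> real" where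
  "shear n Q nabla k p V W = (THE c. \<exists>X Y.
     near Q p (\<lambda>U. section_on Q (null_perp Q) U X \<and> section_on Q (null_perp Q) U Y) \<and>
     X p \<in> V \<and> Y p \<in> W \<and>
     c = 1/2 * lie_metric Q k X Y p
         - 1 / real n * expansion Q nabla k p * metric Q p (X p) (Y p))"

text \<open>Generators are allowed to be defined on arbitrary open sets, global ones included.\<close>

definition geodetic :: "('a, 'n::finite) optical \<Rightarrow> ('a, 'n) cov_deriv \<Rightarrow> bool" where
  "geodetic Q nabla \<longleftrightarrow>
     (\<forall>U k. generator_on Q U k \<longrightarrow> (\<forall>p\<in>U. nabla p (k p) k \<in> null_line Q p))"

definition non_expanding :: "('a, 'n::finite) optical \<Rightarrow> ('a, 'n) cov_deriv \<Rightarrow> bool" where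
  "non_expanding Q nabla \<longleftrightarrow>
     (\<forall>U k. generator_on Q U k \<longrightarrow> (\<forall>p\<in>U. expansion Q nabla k p = 0))"

definition non_twisting :: "('a, 'n::finite) optical \<Rightarrow> bool" where
  "non_twisting Q \<longleftrightarrow>
     (\<forall>U k. generator_on Q U k \<longrightarrow>
        (\<forall>p\<in>U. \<forall>V\<in>screen Q p. \<forall>W\<in>screen Q p. twist Q k p V W = 0))"

definition non_shearing ::
  "nat \<Rightarrow> ('a, 'n::finite) optical \<Rightarrow> ('a, 'n) cov_deriv \<Rightarrow> bool" where
  "non_shearing n Q nabla \<longleftrightarrow>
     (\<forall>U k. generator_on Q U k \<longrightarrow>
        (\<forall>p\<in>U. \<forall>V\<in>screen Q p. \<forall>W\<in>screen Q p. shear n Q nabla k p V W = 0))"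


section \<open>Intrinsic torsion\<close>

text \<open>Elements of \<open>T\<^sup>*M \<otimes> H\<^sub>K\<^sup>* \<otimes> K\<^sup>*\<close> at a point: trilinear maps taking a tangent vector, a
  coset in the screen space and a vector in \<open>K\<close>.\<close>

type_synonym 'n torsion_tensor = "real ^ 'n \<Rightarrow> (real ^ 'n) set \<Rightarrow> real ^ 'n \<Rightarrow> real"

definition bundleG :: "('a, 'n::finite) optical \<Rightarrow> 'a \<Rightarrow> 'n torsion_tensor set" where
  "bundleG Q p = {S.
     (\<forall>W\<in>screen Q p. \<forall>x\<in>null_line Q p. linear (\<lambda>v. S v W x)) \<and>
     (\<forall>v. \<forall>x\<in>null_line Q p. \<forall>w\<in>null_perp Q p. \<forall>w'\<in>null_perp Q p. \<forall>a b.
        S v (coset Q p (a *\<^sub>R w + b *\<^sub>R w')) x = a * S v (coset Q p w) x + b * S v (coset Q p w') x) \<and>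
     (\<forall>v. \<forall>W\<in>screen Q p. \<forall>x\<in>null_line Q p. \<forall>y\<in>null_line Q p. \<forall>a b.
        S v W (a *\<^sub>R x + b *\<^sub>R y) = a * S v W x + b * S v W y)}"

definition intrinsic_torsion ::
  "('a, 'n::finite) optical \<Rightarrow> ('a, 'n) cov_deriv \<Rightarrow> 'a \<Rightarrow> 'n torsion_tensor" where
  "intrinsic_torsion Q nabla p v W x = (THE c. \<exists>k w.
     near Q p (\<lambda>U. section_on Q (null_line Q) U k) \<and> k p = x \<and> w \<in> W \<and>
     c = metric Q p (nabla p v k) w)"

definition bundleG_minus1 :: "('a, 'n::finite) optical \<Rightarrow> 'a \<Rightarrow> 'n torsion_tensor set" where
  "bundleG_minus1 Q p = {S \<in> bundleG Q p.
     \<forall>v\<in>null_line Q p. \<forall>W\<in>screen Q p. \<forall>x\<in>null_line Q p. S v W x = 0}"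

definition bundleG_0 :: "('a, 'n::finite) optical \<Rightarrow> 'a \<Rightarrow> 'n torsion_tensor set" where
  "bundleG_0 Q p = {S \<in> bundleG Q p.
     \<forall>v\<in>null_perp Q p. \<forall>W\<in>screen Q p. \<forall>x\<in>null_line Q p. S v W x = 0}"

text \<open>The projection \<open>\<G>\<^sup>-\<^sup>1 \<rightarrow> \<G>\<^sup>-\<^sup>1 / \<G>\<^sup>0 \<cong> H\<^sub>K\<^sup>* \<otimes> H\<^sub>K\<^sup>* \<otimes> K\<^sup>*\<close>: restrict the first slot to \<open>K\<^sup>\<bottom>\<close>
  and factor it through the quotient by \<open>K\<close>. Its kernel is \<open>bundleG_0\<close>.\<close>

definition graded_image ::
  "'n torsion_tensor \<Rightarrow> (real ^ 'n) set \<Rightarrow> (real ^ 'n) set \<Rightarrow> real ^ 'n \<Rightarrow> real" where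
  "graded_image S V W x = S (SOME v. v \<in> V) W x"

definition bundleN_0 :: "nat \<Rightarrow> ('a, 'n::finite) optical \<Rightarrow> 'a \<Rightarrow> 'n torsion_tensor set" where
  "bundleN_0 n Q p = {S \<in> bundleG_minus1 Q p.
     \<forall>x\<in>null_line Q p. screen_trace n Q p (\<lambda>V W. graded_image S V W x) = 0}"

definition bundleN_1 :: "('a, 'n::finite) optical \<Rightarrow> 'a \<Rightarrow> 'n torsion_tensor set" where
  "bundleN_1 Q p = {S \<in> bundleG_minus1 Q p.
     \<forall>x\<in>null_line Q p. \<forall>V\<in>screen Q p. \<forall>W\<in>screen Q p.
       1/2 * (graded_image S V W x - graded_image S W V x) = 0}"

definition bundleN_2 :: "nat \<Rightarrow> ('a, 'n::finite) optical \<Rightarrow> 'a \<Rightarrow> 'n torsion_tensor set" where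
  "bundleN_2 n Q p = {S \<in> bundleG_minus1 Q p.
     \<forall>x\<in>null_line Q p. \<forall>V\<in>screen Q p. \<forall>W\<in>screen Q p.
       1/2 * (graded_image S V W x + graded_image S W V x)
       - 1 / real n * screen_trace n Q p (\<lambda>V W. graded_image S V W x) * screen_metric Q p V W = 0}"

definition smooth_sections ::
  "('a, 'n::finite) optical \<Rightarrow> ('a \<Rightarrow> 'n torsion_tensor set) \<Rightarrow> ('a \<Rightarrow> 'n torsion_tensor) set" where
  "smooth_sections Q N = {S.
     (\<forall>p\<in>topspace (pts Q). S p \<in> N p) \<and>
     (\<forall>U X w k. openin (pts Q) U \<and> smooth_field Q U X \<and>
        section_on Q (null_perp Q) U w \<and> section_on Q (null_line Q) U k \<longrightarrow>
        smooth_fun Q U (\<lambda>p. S p (X p) (coset Q p (w p)) (k p)))}"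

end

theory Submission
  imports Defs
begin

text \<open>The torsion evaluated on a generator is \<open>g(\<nabla>\<^sub>v k, w)\<close>. Its vanishing for \<open>v\<close> in \<open>K\<close> says that
  \<open>\<nabla>\<^sub>k k\<close> is orthogonal to \<open>K\<^sup>\<bottom>\<close>, hence lies in \<open>K\<close>: the congruence is geodetic. In that case
  \<open>g(\<nabla>\<^sub>v k, w)\<close> descends to a bilinear form \<open>A\<close> on the screen space. Metricity and the absence of
  torsion of \<open>\<nabla>\<close> give \<open>d\<kappa>(v, w) = A(v, w) - A(w, v)\<close> and \<open>(L\<^sub>k g)(v, w) = A(v, w) + A(w, v)\<close>, and
  computing \<open>div k\<close> in a frame adapted to \<open>K\<close> shows that the expansion is the trace of \<open>A\<close>. So
  expansion, twist and shear are the trace, skew and trace-free symmetric parts of \<open>A\<close>. What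
  remains is to extend vectors of \<open>K\<close> and \<open>K\<^sup>\<bottom>\<close> to local sections.\<close>

section \<open>Maps of class \<open>C\<^sup>k\<close>\<close>

lemma Ck_on_subset: "Ck_on k S f \<Longrightarrow> T \<subseteq> S \<Longrightarrow> Ck_on k T f"
  by (induction k arbitrary: f) (auto intro: continuous_on_subset differentiable_on_subset)

lemma Ck_on_Suc_imp: "Ck_on (Suc k) S f \<Longrightarrow> Ck_on k S f"
proof (induction k arbitrary: f)
  case 0
  then show ?case by (simp add: differentiable_imp_continuous_on)
next
  case (Suc k)
  then have "f differentiable_on S" "Ck_on (Suc k) S (\<lambda>x. frechet_derivative f (at x) v)" for v
    by auto
  then show ?case using Suc.IH by (simp del: Ck_on.simps add: Ck_on.simps(2)[of k])
qed

text \<open>Maps that agree on an open set have the same Frechet derivative at each of its points,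
  so agreement passes to every directional derivative. This allows a local representative to be
  replaced by an explicit formula.\<close>

lemma Ck_on_cong:
  assumes "open S" "\<And>x. x \<in> S \<Longrightarrow> f x = g x" "Ck_on k S f"
  shows "Ck_on k S g"
  using assms(2,3)
proof (induction k arbitrary: f g)
  case 0
  then show ?case by (auto intro: continuous_on_eq)
next
  case (Suc k)
  have diff: "f differentiable (at x)" if "x \<in> S" for x
    using Suc.prems(2) assms(1) that by (auto simp: differentiable_on_eq_differentiable_at)
  have eq: "frechet_derivative f (at x) = frechet_derivative g (at x)" if "x \<in> S" for x
    using diff[OF that] Suc.prems(1) that assms(1)
    by (rule_tac frechet_derivative_transform_within_open) auto
  have "g differentiable (at x)" if "x \<in> S" for x
    using diff[OF that] assms(1) that Suc.prems(1)
    unfolding differentiable_def by (metis has_derivative_transform_within_open)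
  then have "g differentiable_on S"
    using assms(1) by (simp add: differentiable_on_eq_differentiable_at)
  moreover have "Ck_on k S (\<lambda>x. frechet_derivative g (at x) v)" for v
    using Suc.IH[of "\<lambda>x. frechet_derivative f (at x) v" "\<lambda>x. frechet_derivative g (at x) v"]
      eq Suc.prems(2) by auto
  ultimately show ?case by auto
qed

lemma Ck_on_const: "Ck_on k S (\<lambda>x. c)"
  by (induction k arbitrary: c) auto

text \<open>The derivative may be supplied by any explicit formula: uniqueness of the derivative on
  an open set identifies it with \<open>frechet_derivative\<close>, which is only given by
  choice.\<close>

lemma Ck_on_SucI:
  assumes "open S"
    and "\<And>x. x \<in> S \<Longrightarrow> (f has_derivative f' x) (at x)"
    and "\<And>v. Ck_on k S (\<lambda>x. f' x v)"
  shows "Ck_on (Suc k) S f"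
proof -
  have "f differentiable_on S"
    using assms(1,2) by (auto simp: differentiable_on_eq_differentiable_at differentiable_def)
  moreover have "Ck_on k S (\<lambda>x. frechet_derivative f (at x) v)" for v
    using assms(1) _ assms(3)[of v] by (rule Ck_on_cong) (metis assms(2) frechet_derivative_at)
  ultimately show ?thesis by simp
qed

lemma Ck_on_SucD:
  assumes "open S" "Ck_on (Suc k) S f" "x \<in> S"
  shows "(f has_derivative frechet_derivative f (at x)) (at x)"
  using assms by (auto simp: differentiable_on_eq_differentiable_at frechet_derivative_works)

section \<open>Sums, products, inverses and compositions of maps of class
  \<open>Ck_on\<close>\<close>

lemma Ck_on_add:
  assumes "open S" "Ck_on k S f" "Ck_on k S g"
  shows "Ck_on k S (\<lambda>x. f x + g x)"
  using assms(2,3)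
proof (induction k arbitrary: f g)
  case 0
  then show ?case by (auto intro: continuous_intros)
next
  case (Suc k)
  show ?case
  proof (rule Ck_on_SucI[OF assms(1)])
    show "((\<lambda>x. f x + g x) has_derivative
        (\<lambda>v. frechet_derivative f (at x) v + frechet_derivative g (at x) v)) (at x)" if "x \<in> S" for x
      using Ck_on_SucD[OF assms(1)] Suc.prems that by (intro has_derivative_add) auto
  qed (use Suc in auto)
qed

lemma Ck_on_sum:
  assumes "open S" "\<And>i. i \<in> I \<Longrightarrow> Ck_on k S (f i)"
  shows "Ck_on k S (\<lambda>x. \<Sum>i\<in>I. f i x)"
  using assms(2)
  by (induction I rule: infinite_finite_induct) (auto intro: Ck_on_const Ck_on_add[OF assms(1)])

lemma Ck_on_bounded_linear:
  assumes "bounded_linear L" "open S" "Ck_on k S f"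
  shows "Ck_on k S (\<lambda>x. L (f x))"
  using assms(3)
proof (induction k arbitrary: f)
  case 0
  then show ?case by (auto intro: bounded_linear.continuous_on[OF assms(1)])
next
  case (Suc k)
  show ?case
  proof (rule Ck_on_SucI[OF assms(2)])
    show "((\<lambda>x. L (f x)) has_derivative (\<lambda>v. L (frechet_derivative f (at x) v))) (at x)"
      if "x \<in> S" for x
      using Ck_on_SucD[OF assms(2) Suc.prems that] by (rule bounded_linear.has_derivative[OF assms(1)])
  qed (use Suc in auto)
qed

text \<open>The product rule gives a sum of two expressions of the same bilinear shape, one factor
  of each being differentiated; hence the induction runs over all \<open>f\<close> and
  \<open>g\<close> at once.\<close>

lemma Ck_on_bounded_bilinear:
  assumes "bounded_bilinear pr" "open S" "Ck_on k S f" "Ck_on k S g"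
  shows "Ck_on k S (\<lambda>x. pr (f x) (g x))"
  using assms(3,4)
proof (induction k arbitrary: f g)
  case 0
  then show ?case by (auto intro: bounded_bilinear.continuous_on[OF assms(1)])
next
  case (Suc k)
  show ?case
  proof (rule Ck_on_SucI[OF assms(2)])
    show "((\<lambda>x. pr (f x) (g x)) has_derivative
        (\<lambda>v. pr (f x) (frechet_derivative g (at x) v)
           + pr (frechet_derivative f (at x) v) (g x))) (at x)" if "x \<in> S" for x
      using Ck_on_SucD[OF assms(2) Suc.prems(1) that] Ck_on_SucD[OF assms(2) Suc.prems(2) that]
      by (rule bounded_bilinear.FDERIV[OF assms(1)])
    show "Ck_on k S (\<lambda>x. pr (f x) (frechet_derivative g (at x) v)
           + pr (frechet_derivative f (at x) v) (g x))" for v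
      using Suc.prems
      by (intro Ck_on_add assms(2) Suc.IH Ck_on_Suc_imp[of k S f] Ck_on_Suc_imp[of k S g]) auto
  qed
qed

lemma Ck_on_inverse:
  fixes f :: "'v::real_normed_vector \<Rightarrow> real"
  assumes "open S" "Ck_on k S f" "\<And>x. x \<in> S \<Longrightarrow> f x \<noteq> 0"
  shows "Ck_on k S (\<lambda>x. inverse (f x))"
  using assms(2)
proof (induction k)
  case 0
  then show ?case using assms(3) by (auto intro: continuous_on_inverse)
next
  case (Suc k)
  have IH: "Ck_on k S (\<lambda>x. inverse (f x))"
    using Suc by (blast dest: Ck_on_Suc_imp)
  show ?case
  proof (rule Ck_on_SucI[OF assms(1)])
    \<comment> \<open>The derivative of the inverse is a product of the inverse itself, covered by
      \<open>IH\<close>, with a derivative of \<open>f\<close>. The sign is written as a constant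
      factor so that closure under products settles it.\<close>
    show "((\<lambda>x. inverse (f x)) has_derivative
        (\<lambda>v. - 1 * (inverse (f x) * frechet_derivative f (at x) v * inverse (f x)))) (at x)"
      if "x \<in> S" for x
      using Deriv.has_derivative_inverse[OF assms(3)[OF that] Ck_on_SucD[OF assms(1) Suc.prems that]] by simp
    show "Ck_on k S (\<lambda>x. - 1 * (inverse (f x) * frechet_derivative f (at x) v * inverse (f x)))" for v
      using Suc.prems
      by (intro Ck_on_bounded_bilinear[OF bounded_bilinear_mult assms(1)] Ck_on_const IH) auto
  qed
qed

lemma linear_eq_sum_Basis:
  fixes L :: "'v::euclidean_space \<Rightarrow> 'w::real_normed_vector"
  assumes "linear L"
  shows "L v = (\<Sum>b\<in>Basis. (v \<bullet> b) *\<^sub>R L b)"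
proof -
  have "L v = L (\<Sum>b\<in>Basis. (v \<bullet> b) *\<^sub>R b)"
    by (simp add: euclidean_representation)
  then show ?thesis
    using assms by (simp add: linear_sum linear_cmul)
qed

lemma Ck_on_compose:
  fixes g :: "'u::real_normed_vector \<Rightarrow> 'v::euclidean_space" and f :: "'v \<Rightarrow> 'w::real_normed_vector"
  assumes "open S" "open T" "Ck_on k S g" "g ` S \<subseteq> T" "Ck_on k T f"
  shows "Ck_on k S (\<lambda>x. f (g x))"
  using assms(3,5)
proof (induction k arbitrary: f)
  case 0
  then show ?case using assms(4) by (auto intro: continuous_on_compose2)
next
  case (Suc k)
  \<comment> \<open>\<open>Ck_on\<close> controls derivatives of \<open>f\<close> in fixed
    directions only, while the direction \<open>frechet_derivative g (at x) v\<close> of the chain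
    rule varies with \<open>x\<close>. Expanding it in \<open>Basis\<close> leaves fixed directions
    \<open>b\<close> with varying scalar coefficients.\<close>
  let ?f' = "\<lambda>x v. \<Sum>b\<in>Basis. (frechet_derivative g (at x) v \<bullet> b) *\<^sub>R frechet_derivative f (at (g x)) b"
  show ?case
  proof (rule Ck_on_SucI[OF assms(1)])
    show "((\<lambda>x. f (g x)) has_derivative ?f' x) (at x)" if "x \<in> S" for x
    proof -
      have g: "(g has_derivative frechet_derivative g (at x)) (at x)"
        using Ck_on_SucD[OF assms(1) Suc.prems(1) that] .
      have f: "(f has_derivative frechet_derivative f (at (g x))) (at (g x))"
        using Ck_on_SucD[OF assms(2) Suc.prems(2)] assms(4) that by auto
      have "?f' x = (\<lambda>v. frechet_derivative f (at (g x)) (frechet_derivative g (at x) v))"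
        by (rule ext, rule linear_eq_sum_Basis[symmetric, OF has_derivative_linear[OF f]])
      then show ?thesis
        using has_derivative_compose[OF g f] by simp
    qed
    have "Ck_on k S (\<lambda>x. frechet_derivative f (at (g x)) b)" for b
      using Suc.prems by (intro Suc.IH[of "\<lambda>y. frechet_derivative f (at y) b"] Ck_on_Suc_imp[of k S g]) auto
    moreover have "Ck_on k S (\<lambda>x. frechet_derivative g (at x) v \<bullet> b)" for v b
      using Suc.prems by (intro Ck_on_bounded_linear[OF bounded_linear_inner_left assms(1)]) auto
    ultimately show "Ck_on k S (\<lambda>x. ?f' x v)" for v
      by (intro Ck_on_sum assms(1) Ck_on_bounded_bilinear[OF bounded_bilinear_scaleR])
  qed
qed

lemma smooth_on_has_derivative:
  assumes "open S" "smooth_on S f" "x \<in> S"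
  shows "(f has_derivative frechet_derivative f (at x)) (at x)"
  using assms Ck_on_SucD unfolding smooth_on_def by blast

lemma smooth_on_cong:
  assumes "open S" "\<And>x. x \<in> S \<Longrightarrow> f x = g x" "smooth_on S f"
  shows "smooth_on S g"
  using assms Ck_on_cong unfolding smooth_on_def by blast

section \<open>Null vectors of a Lorentzian form\<close>

text \<open>Basis independence of the trace: expand each axis vector in \<open>S\<close> and swap
  the sums; for each \<open>b\<close> the inner sum is then the coordinate of \<open>A b\<close>
  along \<open>b\<close>.\<close>

lemma trace_eq_sum_representation:
  fixes A :: "real ^ 'n \<Rightarrow> real ^ 'n::finite"
  assumes A: "linear A" and S: "independent S" "span S = UNIV"
  shows "trace (matrix A) = (\<Sum>b\<in>S. representation S (A b) b)"
proof -
  have fin: "finite S" using S(1) by (simp add: independent_imp_finite)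
  have expand: "v = (\<Sum>b\<in>S. representation S v b *\<^sub>R b)" for v
    by (rule sum_representation_eq[symmetric]) (use S fin in auto)
  have rlin: "linear (\<lambda>v. representation S v b)" for b
    by (rule linearI) (use S in \<open>auto simp: representation_add representation_scale\<close>)
  have "trace (matrix A) = (\<Sum>i\<in>UNIV. A (axis i 1) $ i)"
    by (simp add: trace_def matrix_def)
  also have "\<dots> = (\<Sum>i\<in>UNIV. \<Sum>b\<in>S. representation S (axis i 1) b * A b $ i)"
  proof (rule sum.cong[OF refl])
    fix i :: 'n
    have "A (axis i 1) = (\<Sum>b\<in>S. representation S (axis i 1) b *\<^sub>R A b)"
      by (subst expand[of "axis i 1"]) (simp add: linear_sum[OF A] linear_cmul[OF A])
    then show "A (axis i 1) $ i = (\<Sum>b\<in>S. representation S (axis i 1) b * A b $ i)"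
      by simp
  qed
  also have "\<dots> = (\<Sum>b\<in>S. \<Sum>i\<in>UNIV. representation S (axis i 1) b * A b $ i)"
    by (rule sum.swap)
  also have "\<dots> = (\<Sum>b\<in>S. representation S (A b) b)"
  proof (rule sum.cong[OF refl])
    fix b
    have "A b = (\<Sum>i\<in>UNIV. (A b $ i) *\<^sub>R axis i 1)"
      using basis_expansion[of "A b"] by (simp add: scalar_mult_eq_scaleR)
    then have "representation S (A b) b = (\<Sum>i\<in>UNIV. (A b $ i) * representation S (axis i 1) b)"
      using linear_sum[OF rlin[of b], of "\<lambda>i. (A b $ i) *\<^sub>R axis i 1" UNIV]
      by (simp add: linear_cmul[OF rlin[of b]])
    then show "(\<Sum>i\<in>UNIV. representation S (axis i 1) b * A b $ i) = representation S (A b) b"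
      by (simp add: mult.commute)
  qed
  finally show ?thesis .
qed

text \<open>The frame gives coordinates in which \<open>B\<close> is the Euclidean product with one
  sign flipped, so that Euclidean tools such as orthogonal complements and orthonormal bases
  apply.\<close>

lemma lorentzian_form_coordinates:
  fixes B :: "real ^ 'n::finite \<Rightarrow> real ^ 'n \<Rightarrow> real"
  assumes "lorentzian_form B"
  obtains L :: "real ^ 'n \<Rightarrow> real ^ 'n" and i\<^sub>0 where "linear L" "bij L"
    "\<And>v w. B (L v) (L w) = v \<bullet> w - 2 * (v $ i\<^sub>0 * w $ i\<^sub>0)"
proof -
  obtain e :: "'n \<Rightarrow> real ^ 'n" and i\<^sub>0 where bil: "bilinear B"
    and e: "\<And>i j. B (e i) (e j) = (if i \<noteq> j then 0 else if i = i\<^sub>0 then -1 else 1)"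
    using assms unfolding lorentzian_form_def by blast
  define L :: "real ^ 'n \<Rightarrow> real ^ 'n" where "L v = (\<Sum>i\<in>UNIV. (v $ i) *\<^sub>R e i)" for v
  have lin: "linear L"
    unfolding L_def by (rule linearI) (simp_all add: scaleR_add_left sum.distrib scaleR_sum_right)
  have BL: "B (L v) (L w) = v \<bullet> w - 2 * (v $ i\<^sub>0 * w $ i\<^sub>0)" for v w
  proof -
    have "B (L v) (L w) = (\<Sum>i\<in>UNIV. \<Sum>j\<in>UNIV. (v $ i * w $ j) * B (e i) (e j))"
      unfolding L_def
      by (simp add: bilinear_sum[OF bil] sum.cartesian_product[symmetric] bilinear_lmul[OF bil]
          bilinear_rmul[OF bil] mult_ac del: UNIV_Times_UNIV)
    also have "\<dots> = (\<Sum>i\<in>UNIV. v $ i * w $ i * (if i = i\<^sub>0 then -1 else 1))"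
    proof (rule sum.cong[OF refl])
      fix i
      have "(\<Sum>j\<in>UNIV. (v $ i * w $ j) * B (e i) (e j))
          = (\<Sum>j\<in>UNIV. if j = i then v $ i * w $ i * (if i = i\<^sub>0 then -1 else 1) else 0)"
        by (rule sum.cong) (auto simp: e)
      then show "(\<Sum>j\<in>UNIV. (v $ i * w $ j) * B (e i) (e j))
          = v $ i * w $ i * (if i = i\<^sub>0 then -1 else 1)"
        by simp
    qed
    also have "\<dots> = (\<Sum>i\<in>UNIV. v $ i * w $ i - (if i = i\<^sub>0 then 2 * (v $ i * w $ i) else 0))"
      by (rule sum.cong) auto
    also have "\<dots> = v \<bullet> w - 2 * (v $ i\<^sub>0 * w $ i\<^sub>0)"
      by (simp add: sum_subtractf inner_vec_def)
    finally show ?thesis .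
  qed
  \<comment> \<open>Pairing with the axis vectors gives zero components away from
    \<open>i\<^sub>0\<close>, and an \<open>i\<^sub>0\<close>-component equal to twice
    itself.\<close>
  have "v = 0" if "L v = 0" for v
  proof -
    have "v \<bullet> axis i 1 - 2 * (v $ i\<^sub>0 * axis i 1 $ i\<^sub>0) = 0" for i
      using BL[of v "axis i 1"] that bilinear_lzero[OF bil] by simp
    moreover have "v \<bullet> axis i 1 = v $ i" for i
      by (simp add: inner_axis)
    ultimately have vi: "v $ i = 2 * (v $ i\<^sub>0 * axis i 1 $ i\<^sub>0)" for i
      by (metis eq_iff_diff_eq_0)
    have "v $ i = 0" for i
      using vi[of i] by (cases "i = i\<^sub>0") (simp_all add: axis_def)
    then show ?thesis by (simp add: vec_eq_iff)
  qed
  then have "inj L" using lin by (simp add: linear_injective_0)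
  then have "bij L"
    using lin linear_injective_imp_surjective by (auto simp: bij_def)
  then show thesis using that lin BL by blast
qed

text \<open>Modulo a multiple of \<open>x\<close>, a vector orthogonal to \<open>x\<close> becomes
  purely spatial, where \<open>B\<close> is the Euclidean product. Two uses follow: \<open>K\<close>
  is recovered from its orthogonal complement, and timelike vectors are never orthogonal to
  \<open>K\<close>.\<close>

lemma lorentzian_perp_null:
  fixes B :: "real ^ 'n::finite \<Rightarrow> real ^ 'n \<Rightarrow> real"
  assumes B: "lorentzian_form B" and x: "B x x = 0" "x \<noteq> 0" and w: "B x w = 0"
  shows "B w w \<ge> 0" and "B w w = 0 \<Longrightarrow> w \<in> span {x}"
proof -
  obtain L :: "real ^ 'n \<Rightarrow> real ^ 'n" and i\<^sub>0 where L: "linear L" "bij L"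
    and BL: "\<And>v w. B (L v) (L w) = v \<bullet> w - 2 * (v $ i\<^sub>0 * w $ i\<^sub>0)"
    using lorentzian_form_coordinates[OF B] by blast
  obtain y u where y: "x = L y" and u: "w = L u"
    using L(2) by (metis bij_pointE)
  define a b where "a = y $ i\<^sub>0" and "b = u $ i\<^sub>0"
  have yy: "y \<bullet> y = 2 * a\<^sup>2" and yu: "y \<bullet> u = 2 * (a * b)"
    using x w by (simp_all add: y u BL a_def b_def power2_eq_square)
  have "y \<noteq> 0" using x(2) y linear_0[OF L(1)] by auto
  then have a: "a \<noteq> 0" using yy by auto
  \<comment> \<open>The multiple of \<open>y\<close> is chosen to kill the
    \<open>i\<^sub>0\<close>-component of \<open>u\<close>. As \<open>x\<close> is null and
    orthogonal to \<open>w\<close>, the value of \<open>B\<close> is unchanged, so it equals the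
    Euclidean square of \<open>t\<close>.\<close>
  define t where "t = u - (b / a) *\<^sub>R y"
  have tt: "t \<bullet> t = B w w"
    using a yu by (simp add: t_def u BL inner_diff inner_commute[of u y] yy b_def[symmetric])
      (simp add: field_simps power2_eq_square)
  then show "B w w \<ge> 0" by (metis inner_ge_zero)
  assume "B w w = 0"
  then have "u = (b / a) *\<^sub>R y" using tt by (simp add: t_def)
  then have "w = (b / a) *\<^sub>R x" using linear_cmul[OF L(1)] by (simp add: u y)
  then show "w \<in> span {x}" by (simp add: span_base span_scale)
qed

text \<open>In the coordinates above, the Euclidean complement of the null vector and the time axis
  has dimension \<open>n\<close>. Its vectors have no time component, so a Euclidean orthonormal
  basis of it is orthonormal for \<open>B\<close> and orthogonal to \<open>x\<close>.\<close>

lemma lorentzian_null_screen_basis: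
  fixes B :: "real ^ 'n::finite \<Rightarrow> real ^ 'n \<Rightarrow> real"
  assumes B: "lorentzian_form B" and x: "B x x = 0" "x \<noteq> 0" and n: "CARD('n) = n + 2"
  obtains e :: "nat \<Rightarrow> real ^ 'n" where "\<And>i. i < n \<Longrightarrow> B x (e i) = 0"
    "\<And>i j. i < n \<Longrightarrow> j < n \<Longrightarrow> B (e i) (e j) = (if i = j then 1 else 0)"
proof -
  obtain L :: "real ^ 'n \<Rightarrow> real ^ 'n" and i\<^sub>0 where L: "linear L" "bij L"
    and BL: "\<And>v w. B (L v) (L w) = v \<bullet> w - 2 * (v $ i\<^sub>0 * w $ i\<^sub>0)"
    using lorentzian_form_coordinates[OF B] by blast
  obtain y where y: "x = L y" using L(2) by (metis bij_pointE)
  have yy: "y \<bullet> y = 2 * (y $ i\<^sub>0)\<^sup>2"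
    using x by (simp add: y BL power2_eq_square)
  have y0: "y \<noteq> 0" using x(2) y linear_0[OF L(1)] by auto
  let ?t = "axis i\<^sub>0 1 :: real ^ 'n"
  \<comment> \<open>If \<open>y\<close> were \<open>c\<close> times the time axis, its Euclidean
    square would be both c^2 and 2 c^2, forcing \<open>y = 0\<close>.\<close>
  have y_t: "y \<notin> span {?t}"
  proof
    assume "y \<in> span {?t}"
    then obtain c where "y = c *\<^sub>R ?t" by (auto simp: span_singleton)
    then show False using yy y0 by (auto simp: inner_axis power2_eq_square)
  qed
  have dim_ty: "dim (span {y, ?t}) = 2"
  proof -
    have "y \<noteq> ?t" using y_t span_base by blast
    moreover have "independent {y, ?t}"
      using y_t independent_insertI[of y "{?t}"] by (simp add: axis_eq_0_iff)
    ultimately show ?thesis by (simp add: dim_span dim_eq_card_independent)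
  qed
  define S where "S = {w. \<forall>v\<in>span {y, ?t}. orthogonal v w}"
  have "dim S + dim (span {y, ?t}) = dim (UNIV :: (real ^ 'n) set)"
    using dim_subspace_orthogonal_to_vectors[of "span {y, ?t}" UNIV] by (simp add: S_def)
  then have "dim S = n" using dim_ty n by simp
  moreover have "subspace S"
    unfolding S_def using subspace_orthogonal_comp[of "span {y, ?t}"] by (simp add: orthogonal_comp_def)
  ultimately obtain E where E: "E \<subseteq> S" "pairwise orthogonal E" "\<And>x. x \<in> E \<Longrightarrow> norm x = 1"
    "independent E" "card E = n"
    using orthonormal_basis_subspace[of S] by metis
  obtain f where f: "bij_betw f {..<n} E"
    using E(4,5) independent_imp_finite ex_bij_betw_nat_finite by (metis atLeast0LessThan)
  have fS: "y \<bullet> f i = 0" "f i $ i\<^sub>0 = 0" if "i < n" for i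
  proof -
    have "f i \<in> S" using f E(1) that by (auto simp: bij_betw_def)
    then have "orthogonal y (f i)" "orthogonal ?t (f i)"
      unfolding S_def by (auto simp: span_base)
    then show "y \<bullet> f i = 0" "f i $ i\<^sub>0 = 0"
      by (simp_all add: orthogonal_def inner_axis')
  qed
  show thesis
  proof
    show "B x (L (f i)) = 0" if "i < n" for i
      using fS[OF that] by (simp add: y BL)
    show "B (L (f i)) (L (f j)) = (if i = j then 1 else 0)" if "i < n" "j < n" for i j
    proof (cases "i = j")
      case True
      have "f i \<bullet> f i = 1" using E(3) f that by (auto simp: bij_betw_def norm_eq_1)
      then show ?thesis using True fS that by (simp add: BL)
    next
      case False
      then have "f i \<noteq> f j" using f that by (auto simp: bij_betw_def inj_on_def)
      moreover have "f i \<in> E" "f j \<in> E" using f that by (auto simp: bij_betw_def)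
      ultimately have "f i \<bullet> f j = 0" using E(2) by (auto simp: pairwise_def orthogonal_def)
      then show ?thesis using False fS that by (simp add: BL)
    qed
  qed
qed

text \<open>The vectors \<open>x\<close>, \<open>l\<close> and \<open>e i\<close> form a basis, and
  the diagonal entries of \<open>A\<close> in it are read off with \<open>B\<close>. The entry at
  \<open>l\<close> is zero because the image of \<open>A\<close> is orthogonal to
  \<open>x\<close>.\<close>

lemma trace_adapted_frame:
  fixes B :: "real ^ 'n::finite \<Rightarrow> real ^ 'n \<Rightarrow> real"
  assumes B: "lorentzian_form B" and x: "B x x = 0" "x \<noteq> 0" and n: "CARD('n) = n + 2"
    and e: "\<And>i. i < n \<Longrightarrow> B x (e i) = 0"
      "\<And>i j. i < n \<Longrightarrow> j < n \<Longrightarrow> B (e i) (e j) = (if i = j then 1 else 0)"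
    and l: "B x l \<noteq> 0"
    and A: "linear A" "A x = c *\<^sub>R x" "\<And>v. B x (A v) = 0"
  shows "trace (matrix A) = c + (\<Sum>i<n. B (e i) (A (e i)))"
proof -
  have bil: "bilinear B" and sym: "\<And>v w. B v w = B w v"
    using B unfolding lorentzian_form_def by auto
  have linB: "linear (B v)" for v using bil by (simp add: bilinear_def)
  let ?E = "e ` {..<n}"
  define S where "S = insert x (insert l ?E)"
  have inj: "inj_on e {..<n}"
    by (rule inj_onI) (metis e(2) lessThan_iff zero_neq_one)
  have xE: "x \<notin> ?E"
  proof
    assume "x \<in> ?E"
    then obtain i where "i < n" "x = e i" by auto
    then show False using e(2)[of i i] x by simp
  qed
  have lE: "l \<notin> ?E" using l e(1) by auto
  have xl: "x \<noteq> l" using l x by auto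
  have fin: "finite S" by (simp add: S_def)
  have card: "card S = CARD('n)"
    using xE lE xl n by (simp add: S_def card_image[OF inj])
  have coeffs: "B v (\<Sum>b\<in>S. r b *\<^sub>R b) = r x * B v x + r l * B v l + (\<Sum>i<n. r (e i) * B v (e i))"
    for r v
    using xE lE xl
    by (simp add: S_def sum.reindex[OF inj] linear_add[OF linB] linear_cmul[OF linB]
        linear_sum[OF linB])
  have coeff_l: "B x (\<Sum>b\<in>S. r b *\<^sub>R b) = r l * B x l" for r
    using coeffs[of x r] x e(1) by simp
  \<comment> \<open>The vector \<open>l\<close> is transversal to the complement of \<open>x\<close>
    but may fail to be orthogonal to the \<open>e j\<close>. Hence the coefficient of
    \<open>l\<close> has to be shown to vanish before those of the \<open>e j\<close> can be read
    off.\<close>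
  have coeff_e: "B (e j) (\<Sum>b\<in>S. r b *\<^sub>R b) = r l * B (e j) l + r (e j)" if "j < n" for r j
  proof -
    have "(\<Sum>i<n. r (e i) * B (e j) (e i)) = (\<Sum>i<n. if i = j then r (e j) else 0)"
      by (rule sum.cong) (use that e(2) in auto)
    then show ?thesis using coeffs[of "e j" r] that e(1) sym[of "e j" x] by simp
  qed
  have ind: "independent S"
  proof (rule independent_if_scalars_zero[OF fin])
    fix r b assume r: "(\<Sum>b\<in>S. r b *\<^sub>R b) = 0" and b: "b \<in> S"
    have l0: "r l = 0" using coeff_l[of r] r l linear_0[OF linB] by simp
    have e0: "r (e j) = 0" if "j < n" for j
      using coeff_e[OF that, of r] r l0 linear_0[OF linB] by simp
    have "(\<Sum>b\<in>S. r b *\<^sub>R b) = r x *\<^sub>R x"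
      using xE lE xl l0 e0 by (simp add: S_def sum.reindex[OF inj])
    then have "r x = 0" using r x by simp
    then show "r b = 0" using b l0 e0 by (auto simp: S_def)
  qed
  have span: "span S = UNIV"
    using card_ge_dim_independent[of S UNIV] ind card by auto
  have xS: "x \<in> S" by (simp add: S_def)
  let ?r = "representation S"
  have expand: "(\<Sum>b\<in>S. ?r v b *\<^sub>R b) = v" for v
    by (rule sum_representation_eq) (use ind fin span in auto)
  have "trace (matrix A) = (\<Sum>b\<in>S. ?r (A b) b)"
    by (rule trace_eq_sum_representation[OF A(1) ind span])
  also have "\<dots> = ?r (A x) x + ?r (A l) l + (\<Sum>i<n. ?r (A (e i)) (e i))"
    using xE lE xl by (simp add: S_def sum.reindex[OF inj])
  also have "?r (A x) x = c"
    by (simp add: A(2) representation_scale[OF ind] span representation_basis[OF ind] xS)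
  also have l0: "?r (A v) l = 0" for v
    using coeff_l[of "?r (A v)"] A(3)[of v] l by (simp add: expand)
  have "(\<Sum>i<n. ?r (A (e i)) (e i)) = (\<Sum>i<n. B (e i) (A (e i)))"
    using coeff_e[of _ "?r (A (e _))"] by (intro sum.cong) (auto simp: expand l0)
  finally show ?thesis by (simp add: l0)
qed

section \<open>Charts and smooth fields\<close>

locale charted_manifold =
  fixes Q :: "('a, 'n::finite) optical"
  assumes manifold: "oriented_manifold Q"
begin

lemma chart_at:
  assumes "p \<in> topspace (pts Q)"
  shows "chart_at Q p \<in> atlas Q" "p \<in> fst (chart_at Q p)"
proof -
  have "\<exists>c. c \<in> atlas Q \<and> p \<in> fst c"
    using manifold assms unfolding oriented_manifold_def by blast
  from someI_ex[OF this] show "chart_at Q p \<in> atlas Q" "p \<in> fst (chart_at Q p)"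
    unfolding chart_at_def by auto
qed

lemma openin_chart: "c \<in> atlas Q \<Longrightarrow> openin (pts Q) (fst c)"
  using manifold unfolding oriented_manifold_def by blast

lemma chart_subset: "c \<in> atlas Q \<Longrightarrow> q \<in> fst c \<Longrightarrow> q \<in> topspace (pts Q)"
  using openin_chart openin_subset by blast

lemma homeomorphic_chart:
  assumes "c \<in> atlas Q"
  shows "homeomorphic_map (subtopology (pts Q) (fst c)) (top_of_set (snd c ` fst c)) (snd c)"
    and "open (snd c ` fst c)"
  using manifold assms unfolding oriented_manifold_def by blast+

lemma chart_inv_chart:
  assumes "c \<in> atlas Q" "q \<in> fst c"
  shows "chart_inv c (snd c q) = q"
proof (rule inv_into_f_f)
  have "topspace (pts Q) \<inter> fst c = fst c"
    using chart_subset[OF assms(1)] by blast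
  then show "inj_on (snd c) (fst c)"
    using homeomorphic_chart(1)[OF assms(1)] by (simp add: homeomorphic_map_def)
qed (use assms in auto)

lemma open_chart_image:
  assumes "c \<in> atlas Q" "openin (pts Q) U"
  shows "open (snd c ` (fst c \<inter> U))"
proof -
  have "openin (subtopology (pts Q) (fst c)) (fst c \<inter> U)"
    using assms(2) by (metis openin_subtopology_Int2)
  then have "openin (top_of_set (snd c ` fst c)) (snd c ` (fst c \<inter> U))"
    using homeomorphic_imp_open_map[OF homeomorphic_chart(1)[OF assms(1)]] by (simp add: open_map_def)
  then show ?thesis
    using homeomorphic_chart(2)[OF assms(1)] openin_open_trans by blast
qed

lemma smooth_transition:
  assumes "c \<in> atlas Q" "d \<in> atlas Q"
  shows "smooth_on (snd c ` (fst c \<inter> fst d)) (snd d \<circ> chart_inv c)"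
  using manifold assms unfolding oriented_manifold_def by blast

lemma transition_has_derivative:
  assumes "c \<in> atlas Q" "d \<in> atlas Q" "q \<in> fst c" "q \<in> fst d"
  shows "(snd d \<circ> chart_inv c has_derivative
    frechet_derivative (snd d \<circ> chart_inv c) (at (snd c q))) (at (snd c q))"
  by (rule smooth_on_has_derivative[OF open_chart_image[OF assms(1) openin_chart[OF assms(2)]]
      smooth_transition[OF assms(1,2)]]) (use assms(3,4) in blast)

lemma linear_comps:
  assumes "c \<in> atlas Q" "q \<in> fst c"
  shows "linear (comps Q c q)"
proof -
  have "q \<in> topspace (pts Q)" using assms chart_subset by blast
  then show ?thesis
    using has_derivative_linear[OF transition_has_derivative[OF chart_at(1) assms(1) chart_at(2) assms(2)]]
    by (simp add: comps_def[abs_def])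
qed

section \<open>Smoothness of fields and functions through local representatives\<close>

lemma smooth_field_subset: "smooth_field Q U X \<Longrightarrow> V \<subseteq> U \<Longrightarrow> smooth_field Q V X"
  unfolding smooth_field_def smooth_on_def by (meson Ck_on_subset Int_mono image_mono order_refl)

text \<open>The formula \<open>F c\<close> has to match the representative of \<open>X\<close> on
  the chart image only; outside it \<open>chart_inv c\<close> takes arbitrary values.\<close>

lemma smooth_fieldI:
  assumes "openin (pts Q) U"
    and "\<And>c k. c \<in> atlas Q \<Longrightarrow> Ck_on k (snd c ` (fst c \<inter> U)) (F c)"
    and "\<And>c q. c \<in> atlas Q \<Longrightarrow> q \<in> fst c \<Longrightarrow> q \<in> U \<Longrightarrow> F c (snd c q) = comps Q c q (X q)"
  shows "smooth_field Q U X"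
  unfolding smooth_field_def smooth_on_def
proof (intro ballI allI)
  fix c k assume c: "c \<in> atlas Q"
  show "Ck_on k (snd c ` (fst c \<inter> U)) (local_rep Q c X)"
    by (rule Ck_on_cong[OF open_chart_image[OF c assms(1)] _ assms(2)[OF c]])
      (auto simp: local_rep_def chart_inv_chart[OF c] assms(3)[OF c])
qed

lemma smooth_field_add:
  assumes "openin (pts Q) U" "smooth_field Q U X" "smooth_field Q U Y"
  shows "smooth_field Q U (\<lambda>q. X q + Y q)"
proof (rule smooth_fieldI[OF assms(1)])
  fix c k assume c: "c \<in> atlas Q"
  show "Ck_on k (snd c ` (fst c \<inter> U)) (\<lambda>x. local_rep Q c X x + local_rep Q c Y x)"
    using assms(2,3) c open_chart_image[OF c assms(1)]
    by (intro Ck_on_add) (auto simp: smooth_field_def smooth_on_def)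
next
  fix c q assume "c \<in> atlas Q" "q \<in> fst c" "q \<in> U"
  then show "local_rep Q c X (snd c q) + local_rep Q c Y (snd c q) = comps Q c q (X q + Y q)"
    by (simp add: local_rep_def chart_inv_chart linear_add[OF linear_comps])
qed

lemma smooth_field_scaleR:
  assumes "openin (pts Q) U" "smooth_fun Q U f" "smooth_field Q U X"
  shows "smooth_field Q U (\<lambda>q. f q *\<^sub>R X q)"
proof (rule smooth_fieldI[OF assms(1)])
  fix c k assume c: "c \<in> atlas Q"
  show "Ck_on k (snd c ` (fst c \<inter> U)) (\<lambda>x. (f \<circ> chart_inv c) x *\<^sub>R local_rep Q c X x)"
    using assms(2,3) c open_chart_image[OF c assms(1)]
    by (intro Ck_on_bounded_bilinear[OF bounded_bilinear_scaleR])
      (simp_all add: smooth_field_def smooth_fun_def smooth_on_def comp_def)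
next
  fix c q assume "c \<in> atlas Q" "q \<in> fst c" "q \<in> U"
  then show "(f \<circ> chart_inv c) (snd c q) *\<^sub>R local_rep Q c X (snd c q) = comps Q c q (f q *\<^sub>R X q)"
    by (simp add: local_rep_def chart_inv_chart linear_cmul[OF linear_comps])
qed

lemma smooth_fun_const: "smooth_fun Q U (\<lambda>q. a)"
  by (simp add: smooth_fun_def smooth_on_def comp_def Ck_on_const)

lemma smooth_fun_mult:
  assumes "openin (pts Q) U" "smooth_fun Q U f" "smooth_fun Q U g"
  shows "smooth_fun Q U (\<lambda>q. f q * g q)"
  using assms(2,3) open_chart_image[OF _ assms(1)]
  by (auto simp: smooth_fun_def smooth_on_def comp_def intro!: Ck_on_bounded_bilinear[OF bounded_bilinear_mult])

lemma smooth_fun_inverse: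
  assumes "openin (pts Q) U" "smooth_fun Q U f" "\<And>q. q \<in> U \<Longrightarrow> f q \<noteq> 0"
  shows "smooth_fun Q U (\<lambda>q. inverse (f q))"
  unfolding smooth_fun_def smooth_on_def comp_def
proof (intro ballI allI, rule Ck_on_inverse)
  fix c k assume c: "c \<in> atlas Q"
  show "open (snd c ` (fst c \<inter> U))" by (rule open_chart_image[OF c assms(1)])
  show "Ck_on k (snd c ` (fst c \<inter> U)) (\<lambda>x. f (chart_inv c x))"
    using assms(2) c by (simp add: smooth_fun_def smooth_on_def comp_def)
  show "f (chart_inv c x) \<noteq> 0" if "x \<in> snd c ` (fst c \<inter> U)" for x
    using that assms(3) chart_inv_chart[OF c] by auto
qed

lemma smooth_fun_cong:
  assumes "openin (pts Q) U" "\<And>q. q \<in> U \<Longrightarrow> f q = g q" "smooth_fun Q U f"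
  shows "smooth_fun Q U g"
  unfolding smooth_fun_def
proof
  fix c assume c: "c \<in> atlas Q"
  show "smooth_on (snd c ` (fst c \<inter> U)) (g \<circ> chart_inv c)"
    by (rule smooth_on_cong[OF open_chart_image[OF c assms(1)], of "f \<circ> chart_inv c"])
      (use assms(2,3) c in \<open>auto simp: smooth_fun_def chart_inv_chart\<close>)
qed

text \<open>The field whose components in the chart \<open>c\<close> are constantly \<open>v\<close>.\<close>

definition chart_field :: "'a set \<times> ('a \<Rightarrow> real ^ 'n) \<Rightarrow> real ^ 'n \<Rightarrow> 'a \<Rightarrow> real ^ 'n" where
  "chart_field c v q =
     frechet_derivative (snd (chart_at Q q) \<circ> chart_inv c) (at (snd c q)) v"

text \<open>Near \<open>snd c q\<close> the transition from \<open>c\<close> to \<open>d\<close>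
  factors through the chart chosen at \<open>q\<close>. The chain rule composes the two
  differentials, and the chosen chart drops out.\<close>

lemma comps_chart_field:
  assumes c: "c \<in> atlas Q" "q \<in> fst c" and d: "d \<in> atlas Q" "q \<in> fst d"
  shows "comps Q d q (chart_field c v q) = frechet_derivative (snd d \<circ> chart_inv c) (at (snd c q)) v"
proof -
  let ?e = "chart_at Q q"
  have e: "?e \<in> atlas Q" "q \<in> fst ?e"
    using chart_at chart_subset c by blast+
  have 1: "(snd ?e \<circ> chart_inv c has_derivative
      frechet_derivative (snd ?e \<circ> chart_inv c) (at (snd c q))) (at (snd c q))"
    by (rule transition_has_derivative) (use c e in auto)
  have "(snd d \<circ> chart_inv ?e has_derivative
      frechet_derivative (snd d \<circ> chart_inv ?e) (at (snd ?e q))) (at (snd ?e q))"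
    by (rule transition_has_derivative) (use d e in auto)
  then have 2: "(snd d \<circ> chart_inv ?e has_derivative
      frechet_derivative (snd d \<circ> chart_inv ?e) (at (snd ?e q))) (at ((snd ?e \<circ> chart_inv c) (snd c q)))"
    using c by (simp add: chart_inv_chart)
  let ?U = "fst d \<inter> fst ?e"
  have U: "openin (pts Q) ?U" using openin_chart d e by blast
  have "(snd d \<circ> chart_inv c has_derivative (\<lambda>v. frechet_derivative (snd d \<circ> chart_inv ?e) (at (snd ?e q))
      (frechet_derivative (snd ?e \<circ> chart_inv c) (at (snd c q)) v))) (at (snd c q))"
    by (rule has_derivative_transform_within_open[OF has_derivative_compose[OF 1 2]
          open_chart_image[OF c(1) U]])
      (use c d e in \<open>auto simp: chart_inv_chart\<close>)
  from frechet_derivative_at[OF this] show ?thesis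
    unfolding comps_def chart_field_def by metis
qed

lemma smooth_chart_field:
  assumes c: "c \<in> atlas Q"
  shows "smooth_field Q (fst c) (chart_field c v)"
proof (rule smooth_fieldI[OF openin_chart[OF c]])
  fix d k assume d: "d \<in> atlas Q"
  show "Ck_on k (snd d ` (fst d \<inter> fst c))
      (\<lambda>x. frechet_derivative (snd d \<circ> chart_inv c) (at ((snd c \<circ> chart_inv d) x)) v)"
  proof (rule Ck_on_compose[where T = "snd c ` (fst c \<inter> fst d)" and g = "snd c \<circ> chart_inv d"
        and f = "\<lambda>y. frechet_derivative (snd d \<circ> chart_inv c) (at y) v"])
    show "open (snd d ` (fst d \<inter> fst c))" "open (snd c ` (fst c \<inter> fst d))"
      using c d open_chart_image openin_chart by blast+
    show "Ck_on k (snd d ` (fst d \<inter> fst c)) (snd c \<circ> chart_inv d)"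
      using smooth_transition[OF d c] by (simp add: smooth_on_def)
    show "(snd c \<circ> chart_inv d) ` (snd d ` (fst d \<inter> fst c)) \<subseteq> snd c ` (fst c \<inter> fst d)"
      using d by (auto simp: chart_inv_chart)
    \<comment> \<open>The representative is itself a derivative of a transition map, so one more
      order of differentiability of that map is used.\<close>
    have "Ck_on (Suc k) (snd c ` (fst c \<inter> fst d)) (snd d \<circ> chart_inv c)"
      using smooth_transition[OF c d] unfolding smooth_on_def by blast
    then show "Ck_on k (snd c ` (fst c \<inter> fst d))
        (\<lambda>x. frechet_derivative (snd d \<circ> chart_inv c) (at x) v)"
      by simp
  qed
next
  fix d q assume "d \<in> atlas Q" "q \<in> fst d" "q \<in> fst c"
  then show "frechet_derivative (snd d \<circ> chart_inv c) (at ((snd c \<circ> chart_inv d) (snd d q))) v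
      = comps Q d q (chart_field c v q)"
    using c by (simp add: comps_chart_field chart_inv_chart)
qed

lemma ex_smooth_field:
  assumes "p \<in> topspace (pts Q)"
  obtains U Y where "openin (pts Q) U" "p \<in> U" "smooth_field Q U Y" "Y p = v"
proof
  let ?c = "chart_at Q p"
  have c: "?c \<in> atlas Q" "p \<in> fst ?c" using chart_at assms by auto
  show "openin (pts Q) (fst ?c)" "p \<in> fst ?c" "smooth_field Q (fst ?c) (chart_field ?c v)"
    using c openin_chart smooth_chart_field by blast+
  \<comment> \<open>At \<open>p\<close> the chart \<open>?c\<close> is the chosen one, so the
    transition defining \<open>chart_field\<close> is the identity near \<open>snd ?c p\<close> and
    its differential fixes \<open>v\<close>.\<close>
  have "((\<lambda>x. x) has_derivative (\<lambda>v. v)) (at (snd ?c p))" by simp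
  then have "(snd ?c \<circ> chart_inv ?c has_derivative (\<lambda>v. v)) (at (snd ?c p))"
    by (rule has_derivative_transform_within_open[OF _ homeomorphic_chart(2)[OF c(1)]])
      (use c in \<open>auto simp: chart_inv_chart\<close>)
  from frechet_derivative_at[OF this, symmetric] show "chart_field ?c v p = v"
    by (simp add: chart_field_def)
qed

lemma dir_deriv_locally_zero:
  assumes "openin (pts Q) U" "p \<in> U" "\<And>q. q \<in> U \<Longrightarrow> f q = 0"
  shows "dir_deriv Q p v f = 0"
proof -
  let ?c = "chart_at Q p"
  have "p \<in> topspace (pts Q)" using assms(1,2) openin_subset by blast
  then have c: "?c \<in> atlas Q" "p \<in> fst ?c" using chart_at by auto
  have "((\<lambda>x. 0) has_derivative (\<lambda>v. 0)) (at (snd ?c p))" by simp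
  then have "(f \<circ> chart_inv ?c has_derivative (\<lambda>v. 0)) (at (snd ?c p))"
    by (rule has_derivative_transform_within_open[OF _ open_chart_image[OF c(1) assms(1)]])
      (use c assms(2,3) in \<open>auto simp: chart_inv_chart\<close>)
  from frechet_derivative_at[OF this, symmetric] show ?thesis
    by (simp add: dir_deriv_def)
qed

end

section \<open>Sections of \<open>K\<close> and \<open>K\<^sup>\<bottom>\<close>\<close>

locale optical_connection =
  fixes n :: nat and Q :: "('a, 'n::finite) optical" and nabla :: "('a, 'n) cov_deriv"
  assumes optical: "optical_geometry n Q" and levi_civita: "levi_civita Q nabla"
begin

sublocale charted_manifold Q
  using optical by unfold_locales (simp add: optical_geometry_def)

abbreviation M where "M \<equiv> topspace (pts Q)"
abbreviation g where "g \<equiv> metric Q"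
abbreviation K where "K \<equiv> null_line Q"
abbreviation K_perp where "K_perp \<equiv> null_perp Q"
abbreviation torsion where "torsion \<equiv> intrinsic_torsion Q nabla"

section \<open>Linear algebra of \<open>K\<close> and its orthogonal complement\<close>

lemma in_M: "openin (pts Q) U \<Longrightarrow> p \<in> U \<Longrightarrow> p \<in> M"
  using openin_subset by blast

lemma card_dim: "CARD('n) = n + 2"
  using optical by (simp add: optical_geometry_def)

lemma lorentzian: "p \<in> M \<Longrightarrow> lorentzian_form (g p)"
  using optical by (simp add: optical_geometry_def lorentzian_metric_def)

lemma g_sym: "p \<in> M \<Longrightarrow> g p v w = g p w v"
  using lorentzian unfolding lorentzian_form_def by blast

lemma g_linear: "p \<in> M \<Longrightarrow> linear (g p v)"
  using lorentzian unfolding lorentzian_form_def bilinear_def by blast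

lemmas g_add = linear_add[OF g_linear] and g_diff = linear_diff[OF g_linear]
  and g_scale = linear_cmul[OF g_linear] and g_zero = linear_0[OF g_linear]

lemma g_linear_left: "p \<in> M \<Longrightarrow> linear (\<lambda>v. g p v w)"
  using lorentzian unfolding lorentzian_form_def bilinear_def by blast

lemmas g_add_left = linear_add[OF g_linear_left] and g_diff_left = linear_diff[OF g_linear_left]
  and g_scale_left = linear_cmul[OF g_linear_left]

lemma smooth_fun_g:
  "openin (pts Q) U \<Longrightarrow> smooth_field Q U X \<Longrightarrow> smooth_field Q U Y
    \<Longrightarrow> smooth_fun Q U (\<lambda>p. g p (X p) (Y p))"
  using optical by (simp add: optical_geometry_def lorentzian_metric_def)

lemma subspace_K: "p \<in> M \<Longrightarrow> subspace (K p)"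
  using optical by (simp add: optical_geometry_def null_line_distribution_def)

lemma subspace_K_perp:
  assumes "p \<in> M"
  shows "subspace (K_perp p)"
  unfolding null_perp_def subspace_def
  using assms by (auto simp: g_zero g_add g_scale)

lemma K_null: "p \<in> M \<Longrightarrow> v \<in> K p \<Longrightarrow> g p v v = 0"
  using optical by (simp add: optical_geometry_def null_line_distribution_def)

lemma ex_generator:
  assumes "p \<in> M"
  obtains U k where "generator_on Q U k" "p \<in> U"
  using optical assms
  unfolding optical_geometry_def null_line_distribution_def near_def generator_on_def section_on_def
  by blast

lemma K_eq_span:
  assumes "p \<in> M" "x \<in> K p" "x \<noteq> 0"
  shows "K p = span {x}"
proof
  have "dim (K p) = 1"
    using optical assms(1) by (simp add: optical_geometry_def null_line_distribution_def)
  then show "K p \<subseteq> span {x}"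
    using card_ge_dim_independent[of "{x}" "K p"] assms by simp
  show "span {x} \<subseteq> K p"
    using assms subspace_K by (simp add: span_minimal)
qed

lemma generatorD:
  assumes "generator_on Q U k" "p \<in> U"
  shows "p \<in> M" "k p \<in> K p" "k p \<noteq> 0" "section_on Q K U k" "openin (pts Q) U" "smooth_field Q U k"
  using assms in_M unfolding generator_on_def section_on_def by blast+

lemma K_elim:
  assumes "generator_on Q U k" "p \<in> U" "x \<in> K p"
  obtains a where "x = a *\<^sub>R k p"
  using assms K_eq_span[of p "k p"] generatorD[OF assms(1,2)] by (auto simp: span_singleton)

lemma null_perp_iff:
  assumes "generator_on Q U k" "p \<in> U"
  shows "w \<in> K_perp p \<longleftrightarrow> g p (k p) w = 0"
proof
  show "w \<in> K_perp p \<Longrightarrow> g p (k p) w = 0"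
    using generatorD(2)[OF assms] by (simp add: null_perp_def)
  assume "g p (k p) w = 0"
  then show "w \<in> K_perp p"
    using K_elim[OF assms] generatorD(1)[OF assms]
    unfolding null_perp_def by (force simp: g_scale_left)
qed

lemma K_subset_perp:
  assumes "p \<in> M"
  shows "K p \<subseteq> K_perp p"
proof -
  obtain U k where k: "generator_on Q U k" "p \<in> U" using ex_generator[OF assms] .
  show ?thesis
  proof
    fix x assume "x \<in> K p"
    then obtain a where "x = a *\<^sub>R k p" by (rule K_elim[OF k])
    then show "x \<in> K_perp p"
      using null_perp_iff[OF k] K_null[OF generatorD(1,2)[OF k]] by (simp add: g_scale[OF assms])
  qed
qed

text \<open>Testing against a generator puts \<open>u\<close> into \<open>K_perp\<close>; testing
  against \<open>u\<close> itself shows that it is null. A null vector orthogonal to a null line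
  lies on that line.\<close>

lemma K_perp_perp:
  assumes "p \<in> M" "\<And>w. w \<in> K_perp p \<Longrightarrow> g p u w = 0"
  shows "u \<in> K p"
proof -
  obtain U k where k: "generator_on Q U k" "p \<in> U" using ex_generator[OF assms(1)] .
  note kD = generatorD[OF k]
  have "k p \<in> K_perp p" using K_subset_perp kD by blast
  then have 1: "g p (k p) u = 0" using assms(2) g_sym[OF assms(1), of "k p" u] by simp
  then have "u \<in> K_perp p" using null_perp_iff[OF k] by simp
  then have "g p u u = 0" using assms by simp
  then have "u \<in> span {k p}"
    using lorentzian_perp_null(2)[OF lorentzian[OF kD(1)] K_null[OF kD(1,2)] kD(3) 1] by simp
  then show ?thesis using K_eq_span kD by blast
qed

text \<open>The form is nonnegative on the complement of a null vector, which therefore contains no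
  timelike vector. The time field thus serves as a field transversal to \<open>K_perp\<close>
  wherever one is required.\<close>

lemma time_field_not_perp:
  assumes "generator_on Q U k" "p \<in> U"
  shows "g p (k p) (time_field Q p) \<noteq> 0"
proof
  note kD = generatorD[OF assms]
  assume "g p (k p) (time_field Q p) = 0"
  then have "g p (time_field Q p) (time_field Q p) \<ge> 0"
    using lorentzian_perp_null(1)[OF lorentzian[OF kD(1)] K_null[OF kD(1,2)] kD(3)] by simp
  moreover have "g p (time_field Q p) (time_field Q p) < 0"
    using optical kD(1) by (simp add: optical_geometry_def time_orientation_def)
  ultimately show False by simp
qed

lemma section_on_subset:
  "section_on Q D U X \<Longrightarrow> openin (pts Q) V \<Longrightarrow> V \<subseteq> U \<Longrightarrow> section_on Q D V X"
  unfolding section_on_def using smooth_field_subset by blast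

text \<open>An arbitrary field is made orthogonal to \<open>K\<close> by subtracting a multiple of the time field.\<close>

lemma ex_perp_section:
  assumes "p \<in> M" "w \<in> K_perp p"
  obtains U W where "section_on Q K_perp U W" "p \<in> U" "W p = w"
proof -
  obtain U\<^sub>1 k where k: "generator_on Q U\<^sub>1 k" "p \<in> U\<^sub>1" using ex_generator[OF assms(1)] .
  obtain U\<^sub>2 Y where Y: "openin (pts Q) U\<^sub>2" "p \<in> U\<^sub>2" "smooth_field Q U\<^sub>2 Y" "Y p = w"
    using ex_smooth_field[OF assms(1)] .
  define U where "U = U\<^sub>1 \<inter> U\<^sub>2"
  define Z where "Z = time_field Q"
  define f where "f q = - 1 * (g q (k q) (Y q) * inverse (g q (k q) (Z q)))" for q
  have U: "openin (pts Q) U" using generatorD[OF k] Y by (auto simp: U_def)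
  have "smooth_field Q M Z"
    using optical by (simp add: optical_geometry_def time_orientation_def Z_def)
  then have sm: "smooth_field Q U k" "smooth_field Q U Y" "smooth_field Q U Z"
    using smooth_field_subset generatorD(6)[OF k] Y(3) openin_subset[OF U] by (auto simp: U_def)
  have nz: "g q (k q) (Z q) \<noteq> 0" if "q \<in> U" for q
    using time_field_not_perp[OF k(1)] that by (simp add: U_def Z_def)
  have "smooth_fun Q U f"
    unfolding f_def by (intro smooth_fun_mult smooth_fun_const smooth_fun_inverse smooth_fun_g U sm nz)
  then have smW: "smooth_field Q U (\<lambda>q. Y q + f q *\<^sub>R Z q)"
    by (intro smooth_field_add smooth_field_scaleR U sm)
  have perp: "Y q + f q *\<^sub>R Z q \<in> K_perp q" if "q \<in> U" for q
    using that nz[OF that] in_M[OF U that] null_perp_iff[OF k(1), of q]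
    by (simp add: U_def g_diff g_scale f_def)
  \<comment> \<open>Since \<open>w\<close> is already orthogonal to \<open>K\<close>, the correction
    vanishes at \<open>p\<close> and the prescribed value is kept.\<close>
  have "f p = 0"
    using assms null_perp_iff[OF k] Y(4) by (simp add: f_def)
  with that[of U "\<lambda>q. Y q + f q *\<^sub>R Z q"] show thesis
    using U smW perp k(2) Y(2,4) by (simp add: section_on_def U_def)
qed

lemma ex_K_section:
  assumes "p \<in> M" "x \<in> K p"
  obtains U k where "section_on Q K U k" "p \<in> U" "k p = x"
proof -
  obtain U k where k: "generator_on Q U k" "p \<in> U" using ex_generator[OF assms(1)] .
  obtain a where a: "x = a *\<^sub>R k p" using K_elim[OF k assms(2)] .
  have "section_on Q K U (\<lambda>q. a *\<^sub>R k q)"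
    using generatorD[OF k] smooth_field_scaleR[OF _ smooth_fun_const] subspace_K in_M
    by (auto simp: section_on_def subspace_scale)
  with that a k(2) show thesis by blast
qed


section \<open>The intrinsic torsion\<close>

lemma compat:
  assumes "openin (pts Q) U" "p \<in> U" "smooth_field Q U X" "smooth_field Q U Y"
  shows "dir_deriv Q p v (\<lambda>q. g q (X q) (Y q)) = g p (nabla p v X) (Y p) + g p (X p) (nabla p v Y)"
proof -
  have "near Q p (\<lambda>U. smooth_field Q U X \<and> smooth_field Q U Y)"
    using assms unfolding near_def by blast
  then show ?thesis
    using levi_civita in_M[OF assms(1,2)] by (simp add: levi_civita_def)
qed

lemma torsion_free:
  assumes "openin (pts Q) U" "p \<in> U" "smooth_field Q U X" "smooth_field Q U Y"
  shows "lie_bracket Q X Y p = nabla p (X p) Y - nabla p (Y p) X"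
proof -
  have "near Q p (\<lambda>U. smooth_field Q U X \<and> smooth_field Q U Y)"
    using assms unfolding near_def by blast
  then show ?thesis
    using levi_civita in_M[OF assms(1,2)] by (simp add: levi_civita_def)
qed

lemma linear_nabla:
  assumes "openin (pts Q) U" "p \<in> U" "smooth_field Q U Y"
  shows "linear (\<lambda>v. nabla p v Y)"
proof -
  have "near Q p (\<lambda>U. smooth_field Q U Y)"
    using assms unfolding near_def by blast
  then show ?thesis
    using levi_civita in_M[OF assms(1,2)] by (simp add: levi_civita_def connection_def)
qed

lemma smooth_nabla:
  assumes "openin (pts Q) U" "smooth_field Q U X" "smooth_field Q U Y"
  shows "smooth_field Q U (\<lambda>p. nabla p (X p) Y)"
  using levi_civita assms by (simp add: levi_civita_def connection_def)

text \<open>The function \<open>g(k, W)\<close> vanishes near \<open>p\<close>, so metricity lets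
  the derivative move from \<open>k\<close> to \<open>W\<close> with a sign. On the right only the
  value of \<open>k\<close> at \<open>p\<close> is left.\<close>

lemma nabla_K_perp:
  assumes "section_on Q K U k" "section_on Q K_perp V W" "p \<in> U" "p \<in> V"
  shows "g p (nabla p v k) (W p) = - g p (k p) (nabla p v W)"
proof -
  have S: "openin (pts Q) (U \<inter> V)" "smooth_field Q (U \<inter> V) k" "smooth_field Q (U \<inter> V) W"
    using assms smooth_field_subset unfolding section_on_def by blast+
  have "g q (k q) (W q) = 0" if "q \<in> U \<inter> V" for q
    using assms that by (simp add: section_on_def null_perp_def)
  then have "dir_deriv Q p v (\<lambda>q. g q (k q) (W q)) = 0"
    using assms S(1) by (intro dir_deriv_locally_zero[of "U \<inter> V"]) auto
  then show ?thesis using compat[OF S(1) _ S(2,3), of p v] assms by simp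
qed

text \<open>For a generator \<open>l\<close>, \<open>nabla_K_perp\<close> with \<open>W = l\<close>
  makes \<open>g(nabla_v l, l)\<close> its own negative. Applied to \<open>k\<close> and
  \<open>l\<close>, it brings in only the value \<open>k p\<close>, a multiple of
  \<open>l p\<close>. This makes the torsion independent of the representative of a coset.\<close>

lemma nabla_K_K:
  assumes "section_on Q K U k" "p \<in> U" "x \<in> K p"
  shows "g p (nabla p v k) x = 0"
proof -
  have p: "p \<in> M" using assms in_M unfolding section_on_def by blast
  obtain V l where l: "generator_on Q V l" "p \<in> V" using ex_generator[OF p] .
  note lD = generatorD[OF l]
  have l_perp: "section_on Q K_perp V l"
    using lD(4) K_subset_perp in_M unfolding section_on_def by blast
  have "g p (nabla p v l) (l p) = 0"
    using nabla_K_perp[OF lD(4) l_perp l(2) l(2), of v] g_sym[OF p, of "l p"] by simp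
  moreover obtain a where "k p = a *\<^sub>R l p"
    using K_elim[OF l, of "k p"] assms unfolding section_on_def by blast
  ultimately have "g p (nabla p v k) (l p) = 0"
    using nabla_K_perp[OF assms(1) l_perp assms(2) l(2), of v] g_sym[OF p, of "l p"]
    by (simp add: g_scale_left[OF p])
  moreover obtain b where "x = b *\<^sub>R l p" using K_elim[OF l assms(3)] .
  ultimately show ?thesis by (simp add: g_scale[OF p])
qed

section \<open>Cosets, the screen space and the torsion as a tensor on it\<close>

lemma mem_coset_iff: "y \<in> coset Q p w \<longleftrightarrow> y - w \<in> K p"
  unfolding coset_def by (auto simp: image_iff intro: bexI[of _ "y - w"])

lemma mem_coset: "p \<in> M \<Longrightarrow> w \<in> coset Q p w"
  using subspace_0[OF subspace_K] by (simp add: mem_coset_iff)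

lemma coset_in_screen: "w \<in> K_perp p \<Longrightarrow> coset Q p w \<in> screen Q p"
  by (simp add: screen_def)

lemma screen_memD:
  assumes "p \<in> M" "V \<in> screen Q p" "v \<in> V"
  shows "v \<in> K_perp p" "V = coset Q p v"
proof -
  obtain u where u: "u \<in> K_perp p" "V = coset Q p u" using assms(2) by (auto simp: screen_def)
  then obtain x where x: "x \<in> K p" "v = u + x" using assms(3) by (auto simp: coset_def)
  show "v \<in> K_perp p"
    using u x K_subset_perp[OF assms(1)] subspace_add[OF subspace_K_perp[OF assms(1)]] by blast
  show "V = coset Q p v"
  proof (rule set_eqI)
    fix y
    have "y - u \<in> K p \<longleftrightarrow> y - v \<in> K p"
      using subspace_add[OF subspace_K[OF assms(1)], of "y - v" x]
        subspace_diff[OF subspace_K[OF assms(1)], of "y - u" x] x by (auto simp: algebra_simps)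
    then show "y \<in> V \<longleftrightarrow> y \<in> coset Q p v"
      by (simp add: u(2) mem_coset_iff)
  qed
qed

lemma screen_diff:
  assumes "p \<in> M" "V \<in> screen Q p" "v \<in> V" "v' \<in> V"
  shows "v' - v \<in> K p"
  using screen_memD(2)[OF assms(1-3)] assms(4) by (simp add: mem_coset_iff)

lemma screen_nonempty: "p \<in> M \<Longrightarrow> V \<in> screen Q p \<Longrightarrow> (SOME v. v \<in> V) \<in> V"
  by (rule someI_ex) (auto simp: screen_def intro: mem_coset)

text \<open>The right-hand side does not involve a section of \<open>K\<close> extending \<open>x\<close>: this is why the
  torsion is well defined and linear in its last slot.\<close>

lemma torsion_perp_section:
  assumes "section_on Q K_perp V W" "p \<in> V" "x \<in> K p" "W p \<in> S" "S \<in> screen Q p"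
  shows "torsion p v S x = - g p x (nabla p v W)"
  unfolding intrinsic_torsion_def
proof (rule the_equality)
  have p: "p \<in> M" using assms in_M unfolding section_on_def by blast
  obtain U k where k: "section_on Q K U k" "p \<in> U" "k p = x" using ex_K_section[OF p assms(3)] .
  then have "near Q p (\<lambda>U. section_on Q K U k)" unfolding near_def section_on_def by blast
  then show "\<exists>k w. near Q p (\<lambda>U. section_on Q K U k) \<and> k p = x \<and> w \<in> S \<and>
      - g p x (nabla p v W) = g p (nabla p v k) w"
    using k nabla_K_perp[OF k(1) assms(1) k(2) assms(2)] assms(4) by metis
  fix c assume "\<exists>k w. near Q p (\<lambda>U. section_on Q K U k) \<and> k p = x \<and> w \<in> S \<and>
      c = g p (nabla p v k) w"
  then obtain k w U where k: "section_on Q K U k" "p \<in> U" "k p = x" "w \<in> S"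
      "c = g p (nabla p v k) w"
    unfolding near_def by blast
  \<comment> \<open>Two representatives of \<open>S\<close> differ by a vector of \<open>K\<close>,
    to which \<open>nabla p v k\<close> is orthogonal.\<close>
  have "g p (nabla p v k) (w - W p) = 0"
    by (rule nabla_K_K[OF k(1,2) screen_diff[OF p assms(5,4) k(4)]])
  then have "c = g p (nabla p v k) (W p)"
    using k(5) by (simp add: g_diff[OF p])
  then show "c = - g p x (nabla p v W)"
    using nabla_K_perp[OF k(1) assms(1) k(2) assms(2), of v] k(3) by simp
qed

lemma torsion_eq:
  assumes "section_on Q K U k" "p \<in> U" "w \<in> W" "W \<in> screen Q p"
  shows "torsion p v W (k p) = g p (nabla p v k) w"
proof -
  have p: "p \<in> M" and kp: "k p \<in> K p" using assms in_M unfolding section_on_def by blast+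
  obtain V Y where Y: "section_on Q K_perp V Y" "p \<in> V" "Y p = w"
    using ex_perp_section[OF p screen_memD(1)[OF p assms(4,3)]] .
  then show ?thesis
    using torsion_perp_section[OF Y(1,2) kp _ assms(4), of v] assms(3)
      nabla_K_perp[OF assms(1) Y(1) assms(2) Y(2)] by simp
qed

lemma torsion_linear:
  assumes "p \<in> M" "W \<in> screen Q p" "x \<in> K p"
  shows "linear (\<lambda>v. torsion p v W x)"
proof -
  obtain U k where k: "section_on Q K U k" "p \<in> U" "k p = x" using ex_K_section[OF assms(1,3)] .
  have "torsion p v W x = g p (nabla p v k) (SOME w. w \<in> W)" for v
    using torsion_eq[OF k(1,2) screen_nonempty[OF assms(1,2)] assms(2)] k(3) by simp
  moreover have "linear (\<lambda>v. nabla p v k)"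
    using k linear_nabla unfolding section_on_def by blast
  ultimately show ?thesis
    using linear_compose[OF _ g_linear_left[OF assms(1)], of "\<lambda>v. nabla p v k"] by (simp add: comp_def)
qed

lemma torsion_combination:
  assumes "p \<in> M" "W \<in> screen Q p" "x \<in> K p" "y \<in> K p"
  shows "torsion p v W (a *\<^sub>R x + b *\<^sub>R y) = a * torsion p v W x + b * torsion p v W y"
proof -
  let ?w = "SOME w. w \<in> W"
  have w: "?w \<in> W" using screen_nonempty[OF assms(1,2)] .
  obtain V Y where Y: "section_on Q K_perp V Y" "p \<in> V" "Y p = ?w"
    using ex_perp_section[OF assms(1) screen_memD(1)[OF assms(1,2) w]] .
  have "torsion p v W z = - g p z (nabla p v Y)" if "z \<in> K p" for z
    by (rule torsion_perp_section[OF Y(1,2) that _ assms(2)]) (simp add: Y(3) w)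
  moreover have "a *\<^sub>R x + b *\<^sub>R y \<in> K p"
    using assms subspace_K by (simp add: subspace_add subspace_scale)
  ultimately show ?thesis
    using assms by (simp add: g_add_left g_scale_left)
qed

lemma torsion_scale:
  assumes "p \<in> M" "W \<in> screen Q p" "x \<in> K p"
  shows "torsion p v W (a *\<^sub>R x) = a * torsion p v W x"
  using torsion_combination[OF assms assms(3), of v a 0] by simp

lemma torsion_in_bundleG:
  assumes "p \<in> M"
  shows "torsion p \<in> bundleG Q p"
  unfolding bundleG_def
proof (intro CollectI conjI ballI allI)
  fix v x w w' :: "real ^ 'n" and a b
  assume x: "x \<in> K p" and w: "w \<in> K_perp p" "w' \<in> K_perp p"
  obtain U k where k: "section_on Q K U k" "p \<in> U" "k p = x" using ex_K_section[OF assms x] .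
  have T: "torsion p v (coset Q p u) x = g p (nabla p v k) u" if "u \<in> K_perp p" for u
    using torsion_eq[OF k(1,2) mem_coset[OF assms] coset_in_screen[OF that]] k(3) by simp
  have "a *\<^sub>R w + b *\<^sub>R w' \<in> K_perp p"
    using w subspace_K_perp[OF assms] by (simp add: subspace_add subspace_scale)
  then show "torsion p v (coset Q p (a *\<^sub>R w + b *\<^sub>R w')) x
      = a * torsion p v (coset Q p w) x + b * torsion p v (coset Q p w') x"
    using w assms by (simp add: T g_add g_scale)
qed (use assms torsion_linear torsion_combination in blast)+

lemma torsion_smooth:
  assumes "openin (pts Q) U" "smooth_field Q U X" "section_on Q K_perp U w" "section_on Q K U k"
  shows "smooth_fun Q U (\<lambda>p. torsion p (X p) (coset Q p (w p)) (k p))"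
proof (rule smooth_fun_cong[OF assms(1), of "\<lambda>p. g p (nabla p (X p) k) (w p)"])
  show "g q (nabla q (X q) k) (w q) = torsion q (X q) (coset Q q (w q)) (k q)" if "q \<in> U" for q
    using torsion_eq[OF assms(4) that mem_coset coset_in_screen] in_M[OF assms(1) that]
      assms(3) that by (simp add: section_on_def)
  show "smooth_fun Q U (\<lambda>p. g p (nabla p (X p) k) (w p))"
    using assms unfolding section_on_def by (intro smooth_fun_g smooth_nabla) auto
qed

text \<open>On smooth sections the torsion is \<open>g(nabla_X k, w)\<close>, which is smooth; so
  only the pointwise condition remains.\<close>

lemma torsion_section_iff:
  "torsion \<in> smooth_sections Q N \<longleftrightarrow> (\<forall>p\<in>M. torsion p \<in> N p)"
  unfolding smooth_sections_def using torsion_smooth by blast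

section \<open>The screen metric and orthonormal screen frames\<close>

lemma g_K_perp: "x \<in> K p \<Longrightarrow> w \<in> K_perp p \<Longrightarrow> g p x w = 0"
  by (simp add: null_perp_def)

text \<open>Changing a representative adds a vector of \<open>K\<close>, which is orthogonal to all
  of \<open>K_perp\<close>; hence the choice in \<open>screen_metric\<close> does not affect the
  value.\<close>

lemma screen_metric_eq:
  assumes "p \<in> M" "V \<in> screen Q p" "W \<in> screen Q p" "v \<in> V" "w \<in> W"
  shows "screen_metric Q p V W = g p v w"
proof -
  define v' w' where "v' = (SOME v. v \<in> V)" and "w' = (SOME w. w \<in> W)"
  have vw: "v' \<in> V" "w' \<in> W" using screen_nonempty assms by (auto simp: v'_def w'_def)
  have "g p (v' - v) w = 0"
    using g_K_perp screen_diff[OF assms(1,2,4) vw(1)] screen_memD(1)[OF assms(1,3,5)] by blast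
  moreover have "g p (w' - w) v' = 0"
    using g_K_perp screen_diff[OF assms(1,3,5) vw(2)] screen_memD(1)[OF assms(1,2) vw(1)] by blast
  ultimately have "g p v' w' = g p v w"
    using assms(1) g_sym[OF assms(1), of v'] by (simp add: g_diff_left)
  then show ?thesis by (simp add: screen_metric_def v'_def w'_def)
qed

text \<open>The cosets of a screen basis for a null generator witness the condition under the choice
  in \<open>screen_frame\<close>.\<close>

lemma screen_frame:
  assumes "p \<in> M"
  shows "i < n \<Longrightarrow> screen_frame n Q p i \<in> screen Q p"
    and "i < n \<Longrightarrow> j < n \<Longrightarrow>
      screen_metric Q p (screen_frame n Q p i) (screen_frame n Q p j) = (if i = j then 1 else 0)"
proof -
  obtain U k where k: "generator_on Q U k" "p \<in> U" using ex_generator[OF assms] .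
  note kD = generatorD[OF k]
  obtain e where e: "\<And>i. i < n \<Longrightarrow> g p (k p) (e i) = 0"
    "\<And>i j. i < n \<Longrightarrow> j < n \<Longrightarrow> g p (e i) (e j) = (if i = j then 1 else 0)"
    using lorentzian_null_screen_basis[OF lorentzian[OF kD(1)] K_null[OF kD(1,2)] kD(3) card_dim]
    by blast
  have E: "coset Q p (e i) \<in> screen Q p" if "i < n" for i
    using e(1)[OF that] null_perp_iff[OF k] coset_in_screen by simp
  then have "screen_metric Q p (coset Q p (e i)) (coset Q p (e j)) = (if i = j then 1 else 0)"
    if "i < n" "j < n" for i j
    using screen_metric_eq[OF assms E[OF that(1)] E[OF that(2)] mem_coset[OF assms] mem_coset[OF assms]]
      e(2)[OF that]
    by simp
  with E have "\<exists>E. (\<forall>i<n. E i \<in> screen Q p) \<and>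
     (\<forall>i<n. \<forall>j<n. screen_metric Q p (E i) (E j) = (if i = j then 1 else 0))"
    by (intro exI[of _ "\<lambda>i. coset Q p (e i)"]) blast
  from someI_ex[OF this]
  show "i < n \<Longrightarrow> screen_frame n Q p i \<in> screen Q p"
    and "i < n \<Longrightarrow> j < n \<Longrightarrow>
      screen_metric Q p (screen_frame n Q p i) (screen_frame n Q p j) = (if i = j then 1 else 0)"
    unfolding screen_frame_def by blast+
qed

lemma geodetic_iff: "geodetic Q nabla \<longleftrightarrow> (\<forall>p\<in>M. torsion p \<in> bundleG_minus1 Q p)"
proof
  assume geod: "geodetic Q nabla"
  show "\<forall>p\<in>M. torsion p \<in> bundleG_minus1 Q p"
  proof
    fix p assume p: "p \<in> M"
    obtain U k where k: "generator_on Q U k" "p \<in> U" using ex_generator[OF p] .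
    note kD = generatorD[OF k]
    have "torsion p v W x = 0" if v: "v \<in> K p" and W: "W \<in> screen Q p" and x: "x \<in> K p" for v W x
    proof -
      \<comment> \<open>As \<open>K\<close> is one-dimensional, linearity in the first and last
        slots reduces the claim to the generator in both.\<close>
      obtain a where a: "v = a *\<^sub>R k p" using K_elim[OF k v] .
      obtain b where b: "x = b *\<^sub>R k p" using K_elim[OF k x] .
      let ?w = "SOME w. w \<in> W"
      have w: "?w \<in> W" using screen_nonempty[OF p W] .
      have "nabla p (k p) k \<in> K p" using geod k by (simp add: geodetic_def)
      then have "torsion p (k p) W (k p) = 0"
        using torsion_eq[OF kD(4) k(2) w W] g_K_perp screen_memD(1)[OF p W w] by simp
      then show ?thesis
        using torsion_scale[OF p W kD(2)] linear_cmul[OF torsion_linear[OF p W kD(2)]]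
        by (simp add: a b)
    qed
    then show "torsion p \<in> bundleG_minus1 Q p"
      using torsion_in_bundleG[OF p] by (simp add: bundleG_minus1_def)
  qed
next
  assume T: "\<forall>p\<in>M. torsion p \<in> bundleG_minus1 Q p"
  show "geodetic Q nabla"
    unfolding geodetic_def
  proof (intro allI impI ballI)
    fix U k p assume k: "generator_on Q U k" "p \<in> U"
    note kD = generatorD[OF k]
    show "nabla p (k p) k \<in> K p"
    proof (rule K_perp_perp[OF kD(1)])
      fix w assume w: "w \<in> K_perp p"
      then have "torsion p (k p) (coset Q p w) (k p) = 0"
        using T kD coset_in_screen by (simp add: bundleG_minus1_def)
      then show "g p (nabla p (k p) k) w = 0"
        using torsion_eq[OF kD(4) k(2) mem_coset[OF kD(1)] coset_in_screen[OF w]] by simp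
    qed
  qed
qed

lemma near_sectionE:
  assumes "near Q p (\<lambda>U. section_on Q K_perp U X \<and> section_on Q K_perp U Y)"
    and "generator_on Q U k" "p \<in> U"
  obtains V where "openin (pts Q) V" "p \<in> V" "section_on Q K_perp V X" "section_on Q K_perp V Y"
    "generator_on Q V k"
proof -
  obtain V where V: "openin (pts Q) V" "p \<in> V" "section_on Q K_perp V X" "section_on Q K_perp V Y"
    using assms(1) unfolding near_def by blast
  have "openin (pts Q) (V \<inter> U)" using V(1) generatorD(5)[OF assms(2,3)] by blast
  moreover from this have "generator_on Q (V \<inter> U) k"
    using assms(2) section_on_subset[of K U k "V \<inter> U"] unfolding generator_on_def by blast
  ultimately show thesis
    using that[of "V \<inter> U"] V assms(3) section_on_subset[of K_perp V _ "V \<inter> U"] by blast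
qed

lemma ex_perp_sections:
  assumes "p \<in> M" "V \<in> screen Q p" "W \<in> screen Q p"
  obtains X Y where "near Q p (\<lambda>U. section_on Q K_perp U X \<and> section_on Q K_perp U Y)"
    "X p \<in> V" "Y p \<in> W"
proof -
  have v: "(SOME v. v \<in> V) \<in> V" and w: "(SOME w. w \<in> W) \<in> W"
    using screen_nonempty assms by auto
  obtain U\<^sub>1 X where X: "section_on Q K_perp U\<^sub>1 X" "p \<in> U\<^sub>1" "X p = (SOME v. v \<in> V)"
    using ex_perp_section[OF assms(1) screen_memD(1)[OF assms(1,2) v]] .
  obtain U\<^sub>2 Y where Y: "section_on Q K_perp U\<^sub>2 Y" "p \<in> U\<^sub>2" "Y p = (SOME w. w \<in> W)"
    using ex_perp_section[OF assms(1) screen_memD(1)[OF assms(1,3) w]] .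
  have "openin (pts Q) (U\<^sub>1 \<inter> U\<^sub>2)" using X(1) Y(1) unfolding section_on_def by blast
  then have "near Q p (\<lambda>U. section_on Q K_perp U X \<and> section_on Q K_perp U Y)"
    using X Y section_on_subset unfolding near_def by (meson IntI Int_lower1 Int_lower2)
  then show thesis using that v w X(3) Y(3) by simp
qed

section \<open>Expansion, twist and shear of a geodetic congruence\<close>

abbreviation graded where "graded p x V W \<equiv> graded_image (torsion p) V W x"

lemma graded_scale: "p \<in> M \<Longrightarrow> W \<in> screen Q p \<Longrightarrow> x \<in> K p \<Longrightarrow> graded p (a *\<^sub>R x) V W = a * graded p x V W"
  by (simp add: graded_image_def torsion_scale)

lemma trace_graded_scale:
  "p \<in> M \<Longrightarrow> x \<in> K p \<Longrightarrow> screen_trace n Q p (graded p (a *\<^sub>R x)) = a * screen_trace n Q p (graded p x)"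
  by (simp add: screen_trace_def graded_scale screen_frame sum_distrib_left)

text \<open>This links invariants of generators with tensor conditions on all of \<open>K\<close>:
  each vector of \<open>K\<close>, zero included, is a multiple of the value of a local generator,
  and \<open>P\<close> is stable under scaling.\<close>

lemma ball_K_iff_generators:
  assumes "\<And>p x a. p \<in> M \<Longrightarrow> x \<in> K p \<Longrightarrow> P p x \<Longrightarrow> P p (a *\<^sub>R x)"
  shows "(\<forall>p\<in>M. \<forall>x\<in>K p. P p x) \<longleftrightarrow> (\<forall>U k. generator_on Q U k \<longrightarrow> (\<forall>p\<in>U. P p (k p)))"
proof
  assume L: "\<forall>p\<in>M. \<forall>x\<in>K p. P p x"
  then show "\<forall>U k. generator_on Q U k \<longrightarrow> (\<forall>p\<in>U. P p (k p))"
    using generatorD(1,2) by blast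
next
  assume R: "\<forall>U k. generator_on Q U k \<longrightarrow> (\<forall>p\<in>U. P p (k p))"
  show "\<forall>p\<in>M. \<forall>x\<in>K p. P p x"
  proof (intro ballI)
    fix p x assume p: "p \<in> M" and x: "x \<in> K p"
    obtain U k where k: "generator_on Q U k" "p \<in> U" using ex_generator[OF p] .
    obtain a where "x = a *\<^sub>R k p" using K_elim[OF k x] .
    then show "P p x" using assms[OF p generatorD(2)[OF k]] R k by blast
  qed
qed

context
  assumes geod: "geodetic Q nabla"
begin

text \<open>Representatives of \<open>V\<close> differ by a vector of \<open>K\<close>, on which the
  torsion of a geodetic congruence vanishes; so the choice in \<open>graded_image\<close> may be
  replaced by any \<open>v\<close>.\<close>

lemma graded_eq:
  assumes "generator_on Q U k" "p \<in> U" "V \<in> screen Q p" "W \<in> screen Q p" "v \<in> V" "w \<in> W"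
  shows "graded p (k p) V W = g p (nabla p v k) w"
proof -
  note kD = generatorD[OF assms(1,2)]
  let ?v = "SOME v. v \<in> V"
  have "torsion p (?v - v) W (k p) = 0"
    using geod kD screen_diff[OF kD(1) assms(3,5) screen_nonempty[OF kD(1) assms(3)]] assms(4)
    unfolding geodetic_iff bundleG_minus1_def by blast
  then have "torsion p ?v W (k p) = torsion p v W (k p)"
    using linear_diff[OF torsion_linear[OF kD(1) assms(4) kD(2)], of ?v v] by simp
  then show ?thesis
    using torsion_eq[OF kD(4) assms(2,6,4)] by (simp add: graded_image_def)
qed

text \<open>As \<kappa> annihilates \<open>K_perp\<close>, only the bracket term of its exterior
  derivative survives. Absence of torsion and \<open>nabla_K_perp\<close> rewrite it through
  \<open>nabla k\<close>. The result depends on the cosets alone, which justifies the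
  \<open>THE\<close> in \<open>twist\<close>.\<close>

lemma twist_eq:
  assumes "generator_on Q U k" "p \<in> U" "V \<in> screen Q p" "W \<in> screen Q p"
  shows "twist Q k p V W = graded p (k p) V W - graded p (k p) W V"
  unfolding twist_def
proof (rule the_equality)
  note kD = generatorD[OF assms(1,2)]
  have ext: "ext_deriv Q (flat_form Q k) X Y p = graded p (k p) V W - graded p (k p) W V"
    if near: "near Q p (\<lambda>U. section_on Q K_perp U X \<and> section_on Q K_perp U Y)"
      and XY: "X p \<in> V" "Y p \<in> W" for X Y
  proof -
    obtain S where S: "openin (pts Q) S" "p \<in> S" "section_on Q K_perp S X" "section_on Q K_perp S Y"
      "generator_on Q S k"
      using near_sectionE[OF near assms(1,2)] .
    have sm: "smooth_field Q S X" "smooth_field Q S Y" and kS: "section_on Q K S k"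
      using S generatorD(4)[OF S(5,2)] by (auto simp: section_on_def)
    have "flat_form Q k q (X q) = 0" "flat_form Q k q (Y q) = 0" if "q \<in> S" for q
      using that S kS g_K_perp by (auto simp: section_on_def flat_form_def)
    then have "dir_deriv Q p v (\<lambda>q. flat_form Q k q (X q)) = 0"
      "dir_deriv Q p v (\<lambda>q. flat_form Q k q (Y q)) = 0" for v
      using dir_deriv_locally_zero[OF S(1,2)] by auto
    then have "ext_deriv Q (flat_form Q k) X Y p
        = g p (k p) (nabla p (Y p) X) - g p (k p) (nabla p (X p) Y)"
      using kD(1) by (simp add: ext_deriv_def torsion_free[OF S(1,2) sm] flat_form_def g_diff)
    also have "\<dots> = g p (nabla p (X p) k) (Y p) - g p (nabla p (Y p) k) (X p)"
      using nabla_K_perp[OF kS S(3,2,2)] nabla_K_perp[OF kS S(4,2,2)] by simp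
    finally show ?thesis
      using graded_eq[OF assms XY] graded_eq[OF assms(1,2,4,3) XY(2,1)] by simp
  qed
  show "\<exists>X Y. near Q p (\<lambda>U. section_on Q K_perp U X \<and> section_on Q K_perp U Y) \<and>
      X p \<in> V \<and> Y p \<in> W \<and> graded p (k p) V W - graded p (k p) W V = ext_deriv Q (flat_form Q k) X Y p"
  proof -
    obtain X Y where XY: "near Q p (\<lambda>U. section_on Q K_perp U X \<and> section_on Q K_perp U Y)"
      "X p \<in> V" "Y p \<in> W"
      using ex_perp_sections[OF kD(1) assms(3,4)] .
    then show ?thesis
      using ext[OF XY] by (intro exI[of _ X] exI[of _ Y]) simp
  qed
  show "c = graded p (k p) V W - graded p (k p) W V"
    if "\<exists>X Y. near Q p (\<lambda>U. section_on Q K_perp U X \<and> section_on Q K_perp U Y) \<and>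
      X p \<in> V \<and> Y p \<in> W \<and> c = ext_deriv Q (flat_form Q k) X Y p" for c
    using that ext by blast
qed

text \<open>Writing \<open>[k, X]\<close> as \<open>nabla_k X - nabla_X k\<close>, the terms with
  \<open>nabla_k\<close> cancel against the derivative of \<open>g(X, Y)\<close>, leaving the
  symmetrised \<open>nabla k\<close>. The expansion is kept as a symbol until it is computed
  below.\<close>

lemma shear_eq:
  assumes "generator_on Q U k" "p \<in> U" "V \<in> screen Q p" "W \<in> screen Q p"
  shows "shear n Q nabla k p V W = 1/2 * (graded p (k p) V W + graded p (k p) W V)
    - 1 / real n * expansion Q nabla k p * screen_metric Q p V W" (is "_ = ?s")
  unfolding shear_def
proof (rule the_equality)
  note kD = generatorD[OF assms(1,2)]
  have shear: "1/2 * lie_metric Q k X Y p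
      - 1 / real n * expansion Q nabla k p * metric Q p (X p) (Y p) = ?s"
    if near: "near Q p (\<lambda>U. section_on Q K_perp U X \<and> section_on Q K_perp U Y)"
      and XY: "X p \<in> V" "Y p \<in> W" for X Y
  proof -
    obtain S where S: "openin (pts Q) S" "p \<in> S" "section_on Q K_perp S X" "section_on Q K_perp S Y"
      "generator_on Q S k"
      using near_sectionE[OF near assms(1,2)] .
    have sm: "smooth_field Q S X" "smooth_field Q S Y" "smooth_field Q S k"
      using S generatorD(6)[OF S(5,2)] by (auto simp: section_on_def)
    have "lie_metric Q k X Y p = g p (nabla p (X p) k) (Y p) + g p (X p) (nabla p (Y p) k)"
      using kD(1) by (simp add: lie_metric_def compat[OF S(1,2) sm(1,2)]
          torsion_free[OF S(1,2) sm(3,1)] torsion_free[OF S(1,2) sm(3,2)] g_diff g_diff_left)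
    then have "lie_metric Q k X Y p = graded p (k p) V W + graded p (k p) W V"
      using graded_eq[OF assms XY] graded_eq[OF assms(1,2,4,3) XY(2,1)] g_sym[OF kD(1), of "X p"] by simp
    then show ?thesis using screen_metric_eq[OF kD(1) assms(3,4) XY] by simp
  qed
  show "\<exists>X Y. near Q p (\<lambda>U. section_on Q K_perp U X \<and> section_on Q K_perp U Y) \<and>
      X p \<in> V \<and> Y p \<in> W \<and> ?s = 1/2 * lie_metric Q k X Y p
        - 1 / real n * expansion Q nabla k p * metric Q p (X p) (Y p)"
  proof -
    obtain X Y where XY: "near Q p (\<lambda>U. section_on Q K_perp U X \<and> section_on Q K_perp U Y)"
      "X p \<in> V" "Y p \<in> W"
      using ex_perp_sections[OF kD(1) assms(3,4)] .
    then show ?thesis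
      using shear[OF XY] by (intro exI[of _ X] exI[of _ Y]) simp
  qed
  show "c = ?s"
    if "\<exists>X Y. near Q p (\<lambda>U. section_on Q K_perp U X \<and> section_on Q K_perp U Y) \<and>
      X p \<in> V \<and> Y p \<in> W \<and> c = 1/2 * lie_metric Q k X Y p
        - 1 / real n * expansion Q nabla k p * metric Q p (X p) (Y p)" for c
    using that shear by blast
qed

text \<open>If \<open>\<nabla>\<^sub>k k = c k\<close>, then the expansion is \<open>div k - c\<close>, and \<open>c\<close> is the contribution of the
  direction \<open>k\<close> to the trace computing \<open>div k\<close> in a frame adapted to \<open>K\<close>.\<close>

lemma expansion_eq:
  assumes "generator_on Q U k" "p \<in> U"
  shows "expansion Q nabla k p = screen_trace n Q p (graded p (k p))"
proof -
  note kD = generatorD[OF assms]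
  have "nabla p (k p) k \<in> K p" using geod assms by (simp add: geodetic_def)
  then obtain c where c: "nabla p (k p) k = c *\<^sub>R k p" using K_elim[OF assms] by blast
  define e where "e i = (SOME v. v \<in> screen_frame n Q p i)" for i
  have E: "screen_frame n Q p i \<in> screen Q p" "e i \<in> screen_frame n Q p i" if "i < n" for i
    using screen_frame(1)[OF kD(1) that] screen_nonempty[OF kD(1)] by (auto simp: e_def)
  have div: "divergence nabla k p = c + (\<Sum>i<n. g p (e i) (nabla p (e i) k))"
    unfolding divergence_def
  proof (rule trace_adapted_frame[OF lorentzian[OF kD(1)] K_null[OF kD(1,2)] kD(3) card_dim])
    show "g p (k p) (e i) = 0" if "i < n" for i
      using g_K_perp[OF kD(2) screen_memD(1)[OF kD(1) E[OF that]]] .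
    show "g p (e i) (e j) = (if i = j then 1 else 0)" if "i < n" "j < n" for i j
      using screen_metric_eq[OF kD(1) E(1)[OF that(1)] E(1)[OF that(2)] E(2)[OF that(1)] E(2)[OF that(2)]]
        screen_frame(2)[OF kD(1) that] by simp
    \<comment> \<open>The time field plays the transversal vector \<open>l\<close> of the adapted
      frame.\<close>
    show "g p (k p) (time_field Q p) \<noteq> 0" by (rule time_field_not_perp[OF assms])
    show "linear (\<lambda>v. nabla p v k)" by (rule linear_nabla[OF kD(5) assms(2) kD(6)])
    show "nabla p (k p) k = c *\<^sub>R k p" by (rule c)
    show "g p (k p) (nabla p v k) = 0" for v
      using nabla_K_K[OF kD(4) assms(2) kD(2)] g_sym[OF kD(1)] by metis
  qed
  have "expansion Q nabla k p = divergence nabla k p - c"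
    unfolding expansion_def
  proof (rule the_equality)
    \<comment> \<open>By metricity, the derivative of \<kappa> along \<open>k\<close> is the form
      dual to \<open>nabla_k k\<close>, that is \<open>c\<close> times \<kappa>. Hence div k - c
      solves the defining equation.\<close>
    have cov: "cov_deriv_form Q nabla p (k p) (flat_form Q k) Y = c * flat_form Q k p (Y p)"
      if "near Q p (\<lambda>U. smooth_field Q U Y)" for Y
    proof -
      obtain V where V: "openin (pts Q) V" "p \<in> V" "smooth_field Q V Y"
        using \<open>near Q p (\<lambda>U. smooth_field Q U Y)\<close> unfolding near_def by blast
      have S: "openin (pts Q) (U \<inter> V)" "p \<in> U \<inter> V" using V kD(5) assms(2) by auto
      have "smooth_field Q (U \<inter> V) k" "smooth_field Q (U \<inter> V) Y"
        using V(3) kD(6) smooth_field_subset by blast+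
      from compat[OF S this, of "k p"] show ?thesis
        by (simp add: cov_deriv_form_def flat_form_def c g_scale_left[OF kD(1)])
    qed
    then show "\<forall>Y. near Q p (\<lambda>U. smooth_field Q U Y) \<longrightarrow>
        (divergence nabla k p - c) * flat_form Q k p (Y p) = flat_form Q k p (Y p) * divergence nabla k p
          - cov_deriv_form Q nabla p (k p) (flat_form Q k) Y"
      by (simp add: algebra_simps)
    fix x assume x: "\<forall>Y. near Q p (\<lambda>U. smooth_field Q U Y) \<longrightarrow>
        x * flat_form Q k p (Y p) = flat_form Q k p (Y p) * divergence nabla k p
          - cov_deriv_form Q nabla p (k p) (flat_form Q k) Y"
    \<comment> \<open>Uniqueness: testing with the time field, on which \<kappa> is nonzero, allows
      the factor \<kappa> to be cancelled.\<close>
    have "smooth_field Q M (time_field Q)"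
      using optical by (simp add: optical_geometry_def time_orientation_def)
    then have near: "near Q p (\<lambda>U. smooth_field Q U (time_field Q))"
      using kD(1) openin_topspace unfolding near_def by blast
    then have "x * flat_form Q k p (time_field Q p)
        = (divergence nabla k p - c) * flat_form Q k p (time_field Q p)"
      using x[rule_format, OF near] cov[OF near] by (simp add: algebra_simps)
    moreover have "flat_form Q k p (time_field Q p) \<noteq> 0"
      using time_field_not_perp[OF assms] by (simp add: flat_form_def)
    ultimately show "x = divergence nabla k p - c" by simp
  qed
  then have "expansion Q nabla k p = (\<Sum>i<n. g p (nabla p (e i) k) (e i))"
    using div g_sym[OF kD(1)] by (simp cong: sum.cong)
  also have "\<dots> = screen_trace n Q p (graded p (k p))"
    unfolding screen_trace_def
    by (rule sum.cong) (use graded_eq[OF assms E(1) E(1) E(2) E(2)] in auto)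
  finally show ?thesis .
qed

section \<open>The three invariants as pointwise conditions on the graded torsion\<close>

lemma non_expanding_iff:
  "non_expanding Q nabla \<longleftrightarrow> (\<forall>p\<in>M. \<forall>x\<in>K p. screen_trace n Q p (graded p x) = 0)"
  unfolding non_expanding_def
  by (subst ball_K_iff_generators) (auto simp: trace_graded_scale expansion_eq)

text \<open>The twist is twice the normalised skew part, so both vanish together.\<close>

lemma non_twisting_iff:
  "non_twisting Q \<longleftrightarrow> (\<forall>p\<in>M. \<forall>x\<in>K p. \<forall>V\<in>screen Q p. \<forall>W\<in>screen Q p.
     1/2 * (graded p x V W - graded p x W V) = 0)"
  unfolding non_twisting_def
  by (subst ball_K_iff_generators) (auto simp: graded_scale twist_eq)

lemma non_shearing_iff:
  "non_shearing n Q nabla \<longleftrightarrow> (\<forall>p\<in>M. \<forall>x\<in>K p. \<forall>V\<in>screen Q p. \<forall>W\<in>screen Q p.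
     1/2 * (graded p x V W + graded p x W V)
       - 1 / real n * screen_trace n Q p (graded p x) * screen_metric Q p V W = 0)"
proof -
  let ?s = "\<lambda>p x V W. 1/2 * (graded p x V W + graded p x W V)
       - 1 / real n * screen_trace n Q p (graded p x) * screen_metric Q p V W"
  \<comment> \<open>Every term is homogeneous of degree one in \<open>x\<close>, so vanishing is
    stable under scaling. For \<open>n = 0\<close> the factor \<open>1 / real n\<close> is 0 both
    here and in \<open>shear\<close>.\<close>
  have "?s p (a *\<^sub>R x) V W = a * ?s p x V W"
    if "p \<in> M" "x \<in> K p" "V \<in> screen Q p" "W \<in> screen Q p" for p x V W a
    using that by (simp add: graded_scale trace_graded_scale algebra_simps)
  then have "(\<forall>p\<in>M. \<forall>x\<in>K p. \<forall>V\<in>screen Q p. \<forall>W\<in>screen Q p. ?s p x V W = 0) \<longleftrightarrow>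
      (\<forall>U k. generator_on Q U k \<longrightarrow>
        (\<forall>p\<in>U. \<forall>V\<in>screen Q p. \<forall>W\<in>screen Q p. ?s p (k p) V W = 0))"
    by (intro ball_K_iff_generators) (metis mult_zero_right)
  also have "\<dots> \<longleftrightarrow> non_shearing n Q nabla"
    unfolding non_shearing_def by (simp add: shear_eq expansion_eq)
  finally show ?thesis by simp
qed

end

text \<open>Membership in each subbundle splits into membership in \<open>bundleG_minus1\<close>,
  which is geodeticity, and an algebraic condition. Geodeticity is available on both sides, so the
  equivalences proved under it apply.\<close>

lemma torsion_classification:
  shows "geodetic Q nabla \<and> non_expanding Q nabla \<longleftrightarrow> torsion \<in> smooth_sections Q (bundleN_0 n Q)"
    and "geodetic Q nabla \<and> non_twisting Q \<longleftrightarrow> torsion \<in> smooth_sections Q (bundleN_1 Q)"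
    and "geodetic Q nabla \<and> non_shearing n Q nabla \<longleftrightarrow>
      torsion \<in> smooth_sections Q (bundleN_2 n Q)"
proof -
  have "torsion \<in> smooth_sections Q (bundleN_0 n Q) \<longleftrightarrow> geodetic Q nabla \<and>
      (\<forall>p\<in>M. \<forall>x\<in>K p. screen_trace n Q p (graded p x) = 0)"
    unfolding torsion_section_iff bundleN_0_def geodetic_iff by blast
  then show "geodetic Q nabla \<and> non_expanding Q nabla \<longleftrightarrow>
      torsion \<in> smooth_sections Q (bundleN_0 n Q)"
    using non_expanding_iff by blast
  have "torsion \<in> smooth_sections Q (bundleN_1 Q) \<longleftrightarrow> geodetic Q nabla \<and>
      (\<forall>p\<in>M. \<forall>x\<in>K p. \<forall>V\<in>screen Q p. \<forall>W\<in>screen Q p. 1/2 * (graded p x V W - graded p x W V) = 0)"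
    unfolding torsion_section_iff bundleN_1_def geodetic_iff by blast
  then show "geodetic Q nabla \<and> non_twisting Q \<longleftrightarrow> torsion \<in> smooth_sections Q (bundleN_1 Q)"
    using non_twisting_iff by blast
  have "torsion \<in> smooth_sections Q (bundleN_2 n Q) \<longleftrightarrow> geodetic Q nabla \<and>
      (\<forall>p\<in>M. \<forall>x\<in>K p. \<forall>V\<in>screen Q p. \<forall>W\<in>screen Q p. 1/2 * (graded p x V W + graded p x W V)
       - 1 / real n * screen_trace n Q p (graded p x) * screen_metric Q p V W = 0)"
    unfolding torsion_section_iff bundleN_2_def geodetic_iff by blast
  then show "geodetic Q nabla \<and> non_shearing n Q nabla \<longleftrightarrow>
      torsion \<in> smooth_sections Q (bundleN_2 n Q)"
    using non_shearing_iff by blast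
qed

end

theorem proposition4p11:
  fixes n :: nat
    and Q :: "('a, 'n::finite) optical"
    and nabla :: "('a, 'n) cov_deriv"
  assumes "optical_geometry n Q"
    and "levi_civita Q nabla"
  shows "(geodetic Q nabla \<and> non_expanding Q nabla \<longleftrightarrow>
            intrinsic_torsion Q nabla \<in> smooth_sections Q (bundleN_0 n Q)) \<and>
         (geodetic Q nabla \<and> non_twisting Q \<longleftrightarrow>
            intrinsic_torsion Q nabla \<in> smooth_sections Q (bundleN_1 Q)) \<and>
         (geodetic Q nabla \<and> non_shearing n Q nabla \<longleftrightarrow>
            intrinsic_torsion Q nabla \<in> smooth_sections Q (bundleN_2 n Q))"
proof -
  interpret optical_connection n Q nabla
    using assms by unfold_locales
  show ?thesis using torsion_classification by blast
qed

end
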